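(* Let $q\in\mathbb{C}^\times=\mathbb{C}\setminus\{0\}$, $n\in\mathbb{N}$, and $r\in(0,+\infty]$. (i) There exists a surjective continuous homomorphism $\pi^{\mathrm T}\colon\mathcal{F}^{\mathrm T}(\mathbb{D}^n_r)\to\mathcal{O}_q(\mathbb{D}^n_r)$ such that $\pi^{\mathrm T}(\zeta_i)=x_i$ for $i=1,\dots,n$. (ii) $\mathrm{Ker}\,\pi^{\mathrm T}$ coincides with the closed two-sided ideal of $\mathcal{F}^{\mathrm T}(\mathbb{D}^n_r)$ generated by the elements $\zeta_i\zeta_j-q\zeta_j\zeta_i$ ($i,j=1,\dots,n$, $i<j$). (iii) $\mathrm{Ker}\,\pi^{\mathrm T}$ is a complemented subspace of $\mathcal{F}^{\mathrm T}(\mathbb{D}^n_r)$. (iv) Under the identification $\mathcal{O}_q(\mathbb{D}^n_r)\cong\mathcal{F}^{\mathrm T}(\mathbb{D}^n_r)/\mathrm{Ker}\,\pi^{\mathrm T}$, for each $\rho\in(0,r)$ the norm $\|\cdot\|_{\mathbb{D},\rho}$ on $\mathcal{O}_q(\mathbb{D}^n_r)$ is equal to the quotient of the norm $\|\cdot\|_\rho$ on $\mathcal{F}^{\mathrm T}(\mathbb{D}^n_r)$.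
   Context: All algebras are complex, associative and unital, homomorphisms are unital. $\mathbb{Z}_+=\{0,1,2,\dots\}$; $W_{n,d}=\{1,\dots,n\}^d$, $W_n=\bigsqcup_{d\ge0}W_{n,d}$; for $\alpha\in W_{n,d}$ put $|\alpha|=d$ and $\zeta_\alpha=\zeta_{\alpha_1}\cdots\zeta_{\alpha_d}$ ($=1$ if $d=0$). $\mathfrak{F}_n$ is the algebra of all formal series $\sum_{\alpha\in W_n}c_\alpha\zeta_\alpha$ in free variables $\zeta_1,\dots,\zeta_n$. Taylor's free polydisk algebra is $$\mathcal{F}^{\mathrm T}(\mathbb{D}^n_r)=\Bigl\{f=\sum_{\alpha\in W_n}c_\alpha\zeta_\alpha\in\mathfrak{F}_n:\ \|f\|_\rho=\sum_{\alpha}|c_\alpha|\rho^{|\alpha|}<\infty\ \ \forall\rho\in(0,r)\Bigr\},$$ a Fréchet algebra with multiplication from $\mathfrak{F}_n$ and topology given by the norms $\|\cdot\|_\rho$. The quantum polydisk algebra: for $k\in\mathbb{Z}_+^n$ let $|k|=k_1+\cdots+k_n$ and $w_q(k)=\min\{|q|^{\sum_{i<j}k_ik_j},1\}$. Then $$\mathcal{O}_q(\mathbb{D}^n_r)=\Bigl\{f=\sum_{k\in\mathbb{Z}_+^n}c_kx^k:\ \|f\|_{\mathbb{D},\rho}=\sum_k|c_k|w_q(k)\rho^{|k|}<\infty\ \ \forall\rho\in(0,r)\Bigr\},$$ where $x^k=x_1^{k_1}\cdots x_n^{k_n}$, with topology given by the norms $\|\cdot\|_{\mathbb{D},\rho}$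 and the continuous multiplication uniquely determined by $x_ix_j=qx_jx_i$ for $i<j$; it is a Fréchet algebra and the norms $\|\cdot\|_{\mathbb{D},\rho}$ are submultiplicative. A closed subspace of a Fréchet space is complemented if it has a closed topological complement (equivalently, is the image of a continuous linear projection). The quotient of a norm $\|\cdot\|$ under a surjection $\pi$ is $f\mapsto\inf\{\|a\|:\pi(a)=f\}$. *)

theory Defs
  imports "HOL-Analysis.Analysis" "HOL-Algebra.Module" "HOL-Algebra.Ideal"
    "HOL-Algebra.Algebraic_Closure_Type"
begin

text \<open>Complex algebras are represented by records of type \<open>(complex, 'a) module\<close>, which carry a ring
  structure together with a scalar multiplication.\<close>

section \<open>Topological algebra preliminaries\<close>

abbreviation complex_ring :: "complex ring" where
  "complex_ring \<equiv> ring_of_type_algebra"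

definition algebra_hom :: "(complex, 'a) module \<Rightarrow> (complex, 'b) module \<Rightarrow> ('a \<Rightarrow> 'b) set" where
  "algebra_hom A B =
     {h \<in> ring_hom A B. \<forall>c. \<forall>f\<in>carrier A. h (c \<odot>\<^bsub>A\<^esub> f) = c \<odot>\<^bsub>B\<^esub> h f}"

text \<open>The topology on \<open>A\<close> defined by the family of norms \<open>N \<rho>\<close> with \<open>\<rho> \<in> R\<close>; the open balls are used
  as a subbase.\<close>

definition norm_family_topology ::
    "('a \<Rightarrow> complex) set \<Rightarrow> (real \<Rightarrow> ('a \<Rightarrow> complex) \<Rightarrow> real) \<Rightarrow> real set \<Rightarrow> ('a \<Rightarrow> complex) topology" where
  "norm_family_topology A N R =
     topology_generated_by
       {{g \<in> A. N \<rho> (\<lambda>a. g a - f a) < \<epsilon>} | f \<rho> \<epsilon>. f \<in> A \<and> \<rho> \<in> R \<and> 0 < \<epsilon>}"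

text \<open>In a unital algebra every two-sided ring ideal is closed under scalar multiplication, so the
  ring-theoretic notion of ideal is the algebra-theoretic one.\<close>

definition closed_ideal_generated :: "(complex, 'a) module \<Rightarrow> 'a topology \<Rightarrow> 'a set \<Rightarrow> 'a set" where
  "closed_ideal_generated A T S = \<Inter> {I. ideal I A \<and> closedin T I \<and> S \<subseteq> I}"

text \<open>\<open>L\<close> is a topological complement of \<open>K\<close>: addition is a homeomorphism from \<open>K \<times> L\<close> onto the
  whole space.\<close>

definition complemented_subspace :: "(complex, 'a) module \<Rightarrow> 'a topology \<Rightarrow> 'a set \<Rightarrow> bool" where
  "complemented_subspace A T K \<longleftrightarrow>
     submodule K complex_ring A \<and> closedin T K \<and>
     (\<exists>L. submodule L complex_ring A \<and> closedin T L \<and>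
          homeomorphic_map (prod_topology (subtopology T K) (subtopology T L)) T
            (\<lambda>(x, y). x \<oplus>\<^bsub>A\<^esub> y))"

definition radii :: "ereal \<Rightarrow> real set" where
  "radii r = {\<rho>. 0 < \<rho> \<and> ereal \<rho> < r}"


section \<open>Taylor's free polydisk algebra\<close>

text \<open>A formal series in \<open>\<zeta>\<^sub>1, \<dots>, \<zeta>\<^sub>n\<close> is identified with its coefficient function; words are lists with
  entries in \<open>{1..n}\<close>.\<close>

definition words :: "nat \<Rightarrow> nat list set" where
  "words n = lists {1..n}"

definition free_series :: "nat \<Rightarrow> (complex, nat list \<Rightarrow> complex) module" where
  "free_series n =
     \<lparr>carrier = {f. \<forall>\<alpha>. \<alpha> \<notin> words n \<longrightarrow> f \<alpha> = 0},
      mult = (\<lambda>f g \<alpha>. \<Sum>(\<beta>, \<gamma>) | \<beta> @ \<gamma> = \<alpha>. f \<beta> * g \<gamma>),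
      one = (\<lambda>\<alpha>. if \<alpha> = [] then 1 else 0),
      zero = (\<lambda>\<alpha>. 0),
      add = (\<lambda>f g \<alpha>. f \<alpha> + g \<alpha>),
      smult = (\<lambda>c f \<alpha>. c * f \<alpha>)\<rparr>"

definition free_gen :: "nat \<Rightarrow> nat list \<Rightarrow> complex" where
  "free_gen i = (\<lambda>\<alpha>. if \<alpha> = [i] then 1 else 0)"

definition free_norm :: "nat \<Rightarrow> real \<Rightarrow> (nat list \<Rightarrow> complex) \<Rightarrow> real" where
  "free_norm n \<rho> f = (\<Sum>\<^sub>\<infinity>\<alpha>\<in>words n. norm (f \<alpha>) * \<rho> ^ length \<alpha>)"

definition taylor_polydisk :: "nat \<Rightarrow> ereal \<Rightarrow> (complex, nat list \<Rightarrow> complex) module" where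
  "taylor_polydisk n r = free_series n
     \<lparr>carrier := {f \<in> carrier (free_series n).
        \<forall>\<rho>\<in>radii r. (\<lambda>\<alpha>. norm (f \<alpha>) * \<rho> ^ length \<alpha>) summable_on words n}\<rparr>"

definition taylor_topology :: "nat \<Rightarrow> ereal \<Rightarrow> (nat list \<Rightarrow> complex) topology" where
  "taylor_topology n r =
     norm_family_topology (carrier (taylor_polydisk n r)) (free_norm n) (radii r)"


section \<open>The quantum polydisk algebra\<close>

text \<open>A multi-index is a function on \<open>nat\<close> vanishing outside \<open>{1..n}\<close>, and a series
  \<open>\<Sum>\<^sub>k c\<^sub>k x\<^sup>k\<close> is identified with its coefficient function \<open>k \<mapsto> c\<^sub>k\<close>.\<close>

definition multi_indices :: "nat \<Rightarrow> (nat \<Rightarrow> nat) set" where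
  "multi_indices n = {k. \<forall>i. i \<notin> {1..n} \<longrightarrow> k i = 0}"

definition mi_size :: "nat \<Rightarrow> (nat \<Rightarrow> nat) \<Rightarrow> nat" where
  "mi_size n k = (\<Sum>i=1..n. k i)"

definition q_weight :: "complex \<Rightarrow> nat \<Rightarrow> (nat \<Rightarrow> nat) \<Rightarrow> real" where
  "q_weight q n k = min (norm q ^ (\<Sum>j=1..n. \<Sum>i=1..<j. k i * k j)) 1"

definition quantum_norm :: "complex \<Rightarrow> nat \<Rightarrow> real \<Rightarrow> ((nat \<Rightarrow> nat) \<Rightarrow> complex) \<Rightarrow> real" where
  "quantum_norm q n \<rho> f =
     (\<Sum>\<^sub>\<infinity>k\<in>multi_indices n. norm (f k) * q_weight q n k * \<rho> ^ mi_size n k)"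

definition monom_series :: "(nat \<Rightarrow> nat) \<Rightarrow> (nat \<Rightarrow> nat) \<Rightarrow> complex" where
  "monom_series k = (\<lambda>l. if l = k then 1 else 0)"

definition quantum_gen :: "nat \<Rightarrow> (nat \<Rightarrow> nat) \<Rightarrow> complex" where
  "quantum_gen i = monom_series (\<lambda>j. if j = i then 1 else 0)"

text \<open>The relations \<open>x\<^sub>i x\<^sub>j = q x\<^sub>j x\<^sub>i\<close> (\<open>i < j\<close>) give \<open>x\<^sub>j\<^sup>a x\<^sub>i\<^sup>b = q\<^sup>-\<^sup>a\<^sup>b x\<^sub>i\<^sup>b x\<^sub>j\<^sup>a\<close>, and therefore
  \<open>x\<^sup>k x\<^sup>l = q\<^sup>-\<^sup>s x\<^sup>k\<^sup>+\<^sup>l\<close> for \<open>s = \<Sum>\<^sub>i\<^sub><\<^sub>j k\<^sub>j l\<^sub>i\<close>; by bilinearity and continuity this determines the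
  multiplication. The lemmas below confirm that this product is well defined, makes the quantum polydisk
  into an algebra with submultiplicative norms, satisfies the relations, and that the basis element
  of index \<open>k\<close> is indeed the ordered product \<open>x\<^sub>1 ^ k 1 \<cdots> x\<^sub>n ^ k n\<close>.\<close>

definition q_exponent :: "nat \<Rightarrow> (nat \<Rightarrow> nat) \<Rightarrow> (nat \<Rightarrow> nat) \<Rightarrow> nat" where
  "q_exponent n k l = (\<Sum>j=1..n. \<Sum>i=1..<j. k j * l i)"

definition quantum_mult ::
    "complex \<Rightarrow> nat \<Rightarrow> ((nat \<Rightarrow> nat) \<Rightarrow> complex) \<Rightarrow> ((nat \<Rightarrow> nat) \<Rightarrow> complex) \<Rightarrow> (nat \<Rightarrow> nat) \<Rightarrow> complex" where
  "quantum_mult q n f g m =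
     (\<Sum>(k, l) | k \<in> multi_indices n \<and> l \<in> multi_indices n \<and> (\<lambda>i. k i + l i) = m.
        inverse q ^ q_exponent n k l * f k * g l)"

definition quantum_polydisk :: "complex \<Rightarrow> nat \<Rightarrow> ereal \<Rightarrow> (complex, (nat \<Rightarrow> nat) \<Rightarrow> complex) module" where
  "quantum_polydisk q n r =
     \<lparr>carrier = {f. (\<forall>k. k \<notin> multi_indices n \<longrightarrow> f k = 0) \<and>
        (\<forall>\<rho>\<in>radii r. (\<lambda>k. norm (f k) * q_weight q n k * \<rho> ^ mi_size n k) summable_on multi_indices n)},
      mult = quantum_mult q n,
      one = monom_series (\<lambda>i. 0),
      zero = (\<lambda>k. 0),
      add = (\<lambda>f g k. f k + g k),
      smult = (\<lambda>c f k. c * f k)\<rparr>"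

definition quantum_topology :: "complex \<Rightarrow> nat \<Rightarrow> ereal \<Rightarrow> ((nat \<Rightarrow> nat) \<Rightarrow> complex) topology" where
  "quantum_topology q n r =
     norm_family_topology (carrier (quantum_polydisk q n r)) (quantum_norm q n) (radii r)"

section \<open>The algebras are well defined\<close>

text \<open>Both algebras are weighted convolution algebras over a monoid with finite fibres of the
  multiplication, twisted by a 2-cocycle \<open>s\<close>.\<close>

locale twisted_convolution =
  fixes S :: "'a set" and p :: "'a \<Rightarrow> 'a \<Rightarrow> 'a" and e :: 'a and s :: "'a \<Rightarrow> 'a \<Rightarrow> complex"
  assumes p_closed: "k \<in> S \<Longrightarrow> l \<in> S \<Longrightarrow> p k l \<in> S"
    and p_assoc: "k \<in> S \<Longrightarrow> l \<in> S \<Longrightarrow> m \<in> S \<Longrightarrow> p (p k l) m = p k (p l m)"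
    and e_closed: "e \<in> S" and p_e: "k \<in> S \<Longrightarrow> p k e = k" and e_p: "k \<in> S \<Longrightarrow> p e k = k"
    and fin: "finite {(k, l). k \<in> S \<and> l \<in> S \<and> p k l = m}"
    and s_e: "k \<in> S \<Longrightarrow> s k e = 1" and e_s: "k \<in> S \<Longrightarrow> s e k = 1"
    and cocycle: "k \<in> S \<Longrightarrow> l \<in> S \<Longrightarrow> m \<in> S \<Longrightarrow> s k l * s (p k l) m = s l m * s k (p l m)"
begin

definition fibre :: "'a \<Rightarrow> ('a \<times> 'a) set" where
  "fibre m = {(k, l). k \<in> S \<and> l \<in> S \<and> p k l = m}"

definition conv :: "('a \<Rightarrow> complex) \<Rightarrow> ('a \<Rightarrow> complex) \<Rightarrow> 'a \<Rightarrow> complex" where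
  "conv f g m = (\<Sum>(k, l)\<in>fibre m. s k l * f k * g l)"

definition supp_on :: "('a \<Rightarrow> complex) \<Rightarrow> bool" where
  "supp_on f \<longleftrightarrow> (\<forall>k. k \<notin> S \<longrightarrow> f k = 0)"

lemma finite_fibre: "finite (fibre m)"
  using fin by (simp add: fibre_def)

lemma conv_supp: "supp_on (conv f g)"
proof -
  have "fibre m = {}" if "m \<notin> S" for m
    using that p_closed by (auto simp: fibre_def)
  then show ?thesis by (simp add: supp_on_def conv_def)
qed

lemma conv_assoc: "conv (conv f g) h = conv f (conv g h)"
proof
  fix m
  have "conv (conv f g) h m =
      (\<Sum>x\<in>fibre m. \<Sum>y\<in>fibre (fst x).
         s (fst x) (snd x) * (s (fst y) (snd y) * f (fst y) * g (snd y)) * h (snd x))"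
    by (simp add: conv_def case_prod_beta sum_distrib_left sum_distrib_right)
  also have "\<dots> = (\<Sum>z\<in>(SIGMA x:fibre m. fibre (fst x)).
      s (fst (fst z)) (snd (fst z)) * (s (fst (snd z)) (snd (snd z)) * f (fst (snd z)) * g (snd (snd z)))
        * h (snd (fst z)))"
    by (simp add: sum.Sigma finite_fibre case_prod_beta)
  also have "\<dots> = (\<Sum>z\<in>(SIGMA x:fibre m. fibre (snd x)).
      s (fst (fst z)) (snd (fst z)) * f (fst (fst z)) *
        (s (fst (snd z)) (snd (snd z)) * g (fst (snd z)) * h (snd (snd z))))"
  proof (rule sum.reindex_bij_witness[where
        i = "\<lambda>((a, bc), (b, c)). ((p a b, c), (a, b))" and
        j = "\<lambda>((ab, c), (a, b)). ((a, p b c), (b, c))"], goal_cases)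
    case (5 z)
    then obtain a b c where z: "z = ((p a b, c), (a, b))" "a \<in> S" "b \<in> S" "c \<in> S"
      by (auto simp: fibre_def)
    have "s (p a b) c * s a b = s a (p b c) * s b c"
      using cocycle[OF z(2-4)] by (simp add: mult.commute)
    then show ?case
      by (simp add: z(1))
  qed (auto simp: fibre_def p_closed p_assoc)
  also have "\<dots> = (\<Sum>x\<in>fibre m. \<Sum>y\<in>fibre (snd x).
      s (fst x) (snd x) * f (fst x) * (s (fst y) (snd y) * g (fst y) * h (snd y)))"
    by (simp add: sum.Sigma finite_fibre case_prod_beta)
  also have "\<dots> = conv f (conv g h) m"
    by (simp add: conv_def case_prod_beta sum_distrib_left)
  finally show "conv (conv f g) h m = conv f (conv g h) m" .
qed

lemma conv_single:
  assumes "k \<in> S" "l \<in> S"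
  shows "conv (\<lambda>x. if x = k then 1 else 0) (\<lambda>x. if x = l then 1 else 0) =
    (\<lambda>m. if m = p k l then s k l else 0)"
proof
  fix m
  have "conv (\<lambda>x. if x = k then 1 else 0) (\<lambda>x. if x = l then 1 else 0) m =
      (\<Sum>x\<in>fibre m. if x = (k, l) then s k l else 0)"
    unfolding conv_def by (intro sum.cong) (auto split: if_splits)
  also have "\<dots> = (if (k, l) \<in> fibre m then s k l else 0)"
    by (simp add: finite_fibre)
  finally show "conv (\<lambda>x. if x = k then 1 else 0) (\<lambda>x. if x = l then 1 else 0) m =
    (if m = p k l then s k l else 0)" using assms by (auto simp: fibre_def)
qed

lemma conv_one_left:
  assumes "supp_on f"
  shows "conv (\<lambda>x. if x = e then 1 else 0) f = f"
proof
  fix m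
  have "conv (\<lambda>x. if x = e then 1 else 0) f m = (\<Sum>x\<in>fibre m. if x = (e, m) then f m else 0)"
    unfolding conv_def by (intro sum.cong) (auto simp: fibre_def e_p e_s split: if_splits)
  also have "\<dots> = (if (e, m) \<in> fibre m then f m else 0)"
    by (simp add: finite_fibre)
  finally show "conv (\<lambda>x. if x = e then 1 else 0) f m = f m"
    using assms e_closed e_p by (auto simp: fibre_def supp_on_def)
qed

lemma conv_one_right:
  assumes "supp_on f"
  shows "conv f (\<lambda>x. if x = e then 1 else 0) = f"
proof
  fix m
  have "conv f (\<lambda>x. if x = e then 1 else 0) m = (\<Sum>x\<in>fibre m. if x = (m, e) then f m else 0)"
    unfolding conv_def by (intro sum.cong) (auto simp: fibre_def p_e s_e split: if_splits)
  also have "\<dots> = (if (m, e) \<in> fibre m then f m else 0)"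
    by (simp add: finite_fibre)
  finally show "conv f (\<lambda>x. if x = e then 1 else 0) m = f m"
    using assms e_closed p_e by (auto simp: fibre_def supp_on_def)
qed

lemma conv_add_left: "conv (\<lambda>x. f x + g x) h = (\<lambda>x. conv f h x + conv g h x)"
  by (simp add: conv_def fun_eq_iff case_prod_beta sum.distrib[symmetric] algebra_simps)

lemma conv_add_right: "conv h (\<lambda>x. f x + g x) = (\<lambda>x. conv h f x + conv h g x)"
  by (simp add: conv_def fun_eq_iff case_prod_beta sum.distrib[symmetric] algebra_simps)

lemma conv_scale_left: "conv (\<lambda>x. c * f x) h = (\<lambda>x. c * conv f h x)"
  by (simp add: conv_def fun_eq_iff case_prod_beta sum_distrib_left algebra_simps)

lemma conv_scale_right: "conv h (\<lambda>x. c * f x) = (\<lambda>x. c * conv h f x)"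
  by (simp add: conv_def fun_eq_iff case_prod_beta sum_distrib_left algebra_simps)

lemma conv_norm:
  fixes w :: "'a \<Rightarrow> real"
  assumes w: "\<And>k. k \<in> S \<Longrightarrow> 0 \<le> w k"
    and sw: "\<And>k l. k \<in> S \<Longrightarrow> l \<in> S \<Longrightarrow> norm (s k l) * w (p k l) \<le> w k * w l"
    and f: "(\<lambda>k. norm (f k) * w k) summable_on S" and g: "(\<lambda>k. norm (g k) * w k) summable_on S"
  shows "(\<lambda>m. norm (conv f g m) * w m) summable_on S"
    and "(\<Sum>\<^sub>\<infinity>m\<in>S. norm (conv f g m) * w m) \<le>
      (\<Sum>\<^sub>\<infinity>k\<in>S. norm (f k) * w k) * (\<Sum>\<^sub>\<infinity>k\<in>S. norm (g k) * w k)"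
proof -
  define u where "u = (\<lambda>(k, l). (norm (f k) * w k) * (norm (g l) * w l))"
  have u_sum: "u summable_on S \<times> S"
  proof -
    have "(\<lambda>x. norm (u x)) summable_on S \<times> S"
      unfolding Infinite_Sum.abs_summable_on_Sigma_iff
    proof (intro conjI ballI)
      fix k assume "k \<in> S"
      have "(\<lambda>l. u (k, l)) summable_on S"
        using summable_on_cmult_right[OF g] by (simp add: u_def)
      then show "(\<lambda>l. norm (u (k, l))) summable_on S"
        by (rule Infinite_Sum.summable_on_iff_abs_summable_on_real[THEN iffD1])
    next
      have "(\<Sum>\<^sub>\<infinity>l\<in>S. norm (u (k, l))) =
          (norm (f k) * w k) * (\<Sum>\<^sub>\<infinity>l\<in>S. norm (g l) * w l)" if "k \<in> S" for k
        using w that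
        by (subst infsum_cmult_right'[symmetric]) (auto simp: u_def abs_mult intro!: infsum_cong)
      then have "(\<lambda>k. \<Sum>\<^sub>\<infinity>l\<in>S. norm (u (k, l))) summable_on S"
        using summable_on_cmult_left[OF f] by (simp cong: summable_on_cong)
      then show "(\<lambda>k. norm (\<Sum>\<^sub>\<infinity>l\<in>S. norm (u (k, l)))) summable_on S"
        by (rule Infinite_Sum.summable_on_iff_abs_summable_on_real[THEN iffD1])
    qed
    then show ?thesis by (rule Infinite_Sum.abs_summable_summable)
  qed
  have u_inf: "infsum u (S \<times> S) = (\<Sum>\<^sub>\<infinity>k\<in>S. norm (f k) * w k) * (\<Sum>\<^sub>\<infinity>k\<in>S. norm (g k) * w k)"
    using infsum_Sigma_banach[OF u_sum] by (simp add: u_def infsum_cmult_right' infsum_cmult_left')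
  have bij: "bij_betw snd (SIGMA m:S. fibre m) (S \<times> S)"
    by (rule bij_betw_byWitness[where f' = "\<lambda>(k, l). (p k l, (k, l))"])
      (auto simp: fibre_def p_closed)
  have u_sum': "(\<lambda>z. u (snd z)) summable_on (SIGMA m:S. fibre m)"
    using u_sum by (simp add: summable_on_reindex_bij_betw[OF bij])
  have fib: "(\<lambda>m. sum u (fibre m)) summable_on S"
    using summable_on_SigmaD[OF u_sum'] finite_fibre by simp
  have fib_inf: "(\<Sum>\<^sub>\<infinity>m\<in>S. sum u (fibre m)) = infsum u (S \<times> S)"
    using infsum_Sigma_banach[OF u_sum'] finite_fibre
    by (simp add: infsum_reindex_bij_betw[OF bij])
  have le: "norm (conv f g m) * w m \<le> sum u (fibre m)" if m: "m \<in> S" for m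
  proof -
    have "norm (conv f g m) * w m \<le> (\<Sum>(k, l)\<in>fibre m. norm (s k l * f k * g l)) * w m"
      unfolding conv_def case_prod_beta by (intro mult_right_mono sum_norm_le w m) auto
    also have "\<dots> = (\<Sum>(k, l)\<in>fibre m. norm (s k l * f k * g l) * w m)"
      by (simp add: sum_distrib_right case_prod_beta)
    also have "\<dots> \<le> sum u (fibre m)"
    proof (rule sum_mono, clarify)
      fix k l assume "(k, l) \<in> fibre m"
      then have kl: "k \<in> S" "l \<in> S" and m: "m = p k l" by (auto simp: fibre_def)
      have "norm (f k) * norm (g l) * (norm (s k l) * w (p k l)) \<le> norm (f k) * norm (g l) * (w k * w l)"
        by (intro mult_left_mono sw kl) auto
      then show "norm (s k l * f k * g l) * w m \<le> u (k, l)"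
        by (simp add: u_def m norm_mult mult_ac)
    qed
    finally show ?thesis .
  qed
  show *: "(\<lambda>m. norm (conv f g m) * w m) summable_on S"
    by (rule summable_on_comparison_test[OF fib]) (auto simp: le w)
  show "(\<Sum>\<^sub>\<infinity>m\<in>S. norm (conv f g m) * w m) \<le>
      (\<Sum>\<^sub>\<infinity>k\<in>S. norm (f k) * w k) * (\<Sum>\<^sub>\<infinity>k\<in>S. norm (g k) * w k)"
    using infsum_mono[OF * fib le] by (simp add: fib_inf u_inf)
qed

text \<open>Rings of weighted summable series, for an arbitrary set \<open>W\<close> of weights.\<close>

lemma ring_conv:
  fixes W :: "('a \<Rightarrow> real) set" and R :: "('a \<Rightarrow> complex, 'm) ring_scheme"
  assumes w: "\<And>w k. w \<in> W \<Longrightarrow> k \<in> S \<Longrightarrow> 0 \<le> w k"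
    and sw: "\<And>w k l. w \<in> W \<Longrightarrow> k \<in> S \<Longrightarrow> l \<in> S \<Longrightarrow> norm (s k l) * w (p k l) \<le> w k * w l"
    and R: "carrier R = {f. supp_on f \<and> (\<forall>w\<in>W. (\<lambda>k. norm (f k) * w k) summable_on S)}"
      "one R = (\<lambda>x. if x = e then 1 else 0)" "zero R = (\<lambda>x. 0)"
      "add R = (\<lambda>f g x. f x + g x)"
    and mult: "\<And>f g. f \<in> carrier R \<Longrightarrow> g \<in> carrier R \<Longrightarrow> f \<otimes>\<^bsub>R\<^esub> g = conv f g"
  shows "ring R"
proof (rule ringI)
  have single: "(\<lambda>k. norm (if k = e then 1 else 0 :: complex) * w k) summable_on S" for w
  proof -
    have "(\<lambda>k. norm (if k = e then 1 else 0 :: complex) * w k) summable_on {e}" by simp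
    then show ?thesis
      by (rule summable_on_cong_neutral[THEN iffD1, rotated -1]) (use e_closed in auto)
  qed
  have add: "(\<lambda>k. norm (f k + g k) * w k) summable_on S"
    if "w \<in> W" "(\<lambda>k. norm (f k) * w k) summable_on S" "(\<lambda>k. norm (g k) * w k) summable_on S"
    for w and f g :: "'a \<Rightarrow> complex"
    by (rule summable_on_comparison_test[OF summable_on_add[OF that(2,3)]])
      (use w[OF that(1)] in \<open>auto simp flip: distrib_right intro!: mult_right_mono norm_triangle_ineq\<close>)
  show "abelian_group R"
  proof (rule abelian_groupI)
    fix f assume "f \<in> carrier R"
    then show "\<exists>g\<in>carrier R. g \<oplus>\<^bsub>R\<^esub> f = \<zero>\<^bsub>R\<^esub>"
      by (intro bexI[of _ "\<lambda>x. - f x"]) (auto simp: R supp_on_def)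
  qed (use add in \<open>auto simp: R supp_on_def algebra_simps\<close>)
  have sum: "(\<lambda>x. f x + g x) \<in> carrier R" if "f \<in> carrier R" "g \<in> carrier R" for f g
    using that add by (auto simp: R supp_on_def)
  have one: "(\<lambda>x. if x = e then 1 else 0) \<in> carrier R"
    using e_closed single by (auto simp: R supp_on_def)
  have closed: "conv f g \<in> carrier R" if "f \<in> carrier R" "g \<in> carrier R" for f g
    using that conv_norm(1) w sw by (auto simp: R conv_supp)
  show "monoid R"
    by (rule monoidI)
      (auto simp: R(2) mult closed one conv_assoc, auto simp: R conv_one_left conv_one_right)
  fix f g h assume fgh: "f \<in> carrier R" "g \<in> carrier R" "h \<in> carrier R"
  show "(f \<oplus>\<^bsub>R\<^esub> g) \<otimes>\<^bsub>R\<^esub> h = f \<otimes>\<^bsub>R\<^esub> h \<oplus>\<^bsub>R\<^esub> g \<otimes>\<^bsub>R\<^esub> h"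
    and "h \<otimes>\<^bsub>R\<^esub> (f \<oplus>\<^bsub>R\<^esub> g) = h \<otimes>\<^bsub>R\<^esub> f \<oplus>\<^bsub>R\<^esub> h \<otimes>\<^bsub>R\<^esub> g"
    using fgh sum by (simp_all add: mult R(4) conv_add_left conv_add_right)
qed

end

subsection \<open>The free polydisk algebra\<close>

lemma finite_splits:
  fixes \<alpha> :: "'b list"
  shows "finite {(\<beta>, \<gamma>). \<beta> @ \<gamma> = \<alpha>}"
proof (rule finite_subset)
  show "{(\<beta>, \<gamma>). \<beta> @ \<gamma> = \<alpha>} \<subseteq> (\<lambda>i. (take i \<alpha>, drop i \<alpha>)) ` {..length \<alpha>}"
  proof clarify
    fix \<beta> \<gamma> :: "'b list"
    have "(\<beta>, \<gamma>) = (take (length \<beta>) (\<beta> @ \<gamma>), drop (length \<beta>) (\<beta> @ \<gamma>))" by simp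
    then show "(\<beta>, \<gamma>) \<in> (\<lambda>i. (take i (\<beta> @ \<gamma>), drop i (\<beta> @ \<gamma>))) ` {..length (\<beta> @ \<gamma>)}"
      by (rule image_eqI) simp
  qed
qed auto

interpretation free: twisted_convolution "words n" "(@)" "[]" "\<lambda>_ _. 1" for n
  by unfold_locales
    (auto simp: words_def intro: finite_subset[OF _ finite_splits])

lemma free_mult_eq_conv:
  assumes "f \<in> carrier (taylor_polydisk n r)" "g \<in> carrier (taylor_polydisk n r)"
  shows "f \<otimes>\<^bsub>taylor_polydisk n r\<^esub> g = free.conv n f g"
proof
  fix \<alpha>
  have "(\<Sum>(\<beta>, \<gamma>) | \<beta> @ \<gamma> = \<alpha>. f \<beta> * g \<gamma>) = (\<Sum>(\<beta>, \<gamma>)\<in>free.fibre n \<alpha>. f \<beta> * g \<gamma>)"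
    by (rule sum.mono_neutral_right[OF finite_splits])
      (use assms in \<open>auto simp: free.fibre_def taylor_polydisk_def free_series_def\<close>)
  then show "(f \<otimes>\<^bsub>taylor_polydisk n r\<^esub> g) \<alpha> = free.conv n f g \<alpha>"
    by (simp add: taylor_polydisk_def free_series_def free.conv_def)
qed

lemma ring_taylor_polydisk: "ring (taylor_polydisk n r)"
proof (rule free.ring_conv[where n = n and W = "(\<lambda>\<rho> \<alpha>. \<rho> ^ length \<alpha>) ` radii r"])
  show "carrier (taylor_polydisk n r) = {f. free.supp_on n f \<and>
      (\<forall>w\<in>(\<lambda>\<rho> \<alpha>. \<rho> ^ length \<alpha>) ` radii r. (\<lambda>k. norm (f k) * w k) summable_on words n)}"
    by (auto simp: taylor_polydisk_def free_series_def free.supp_on_def)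
qed (simp_all add: free_mult_eq_conv,
    auto simp: taylor_polydisk_def free_series_def radii_def power_add)

lemma module_taylor_polydisk: "module complex_ring (taylor_polydisk n r)"
proof (rule moduleI)
  show "cring complex_ring" ..
  show "abelian_group (taylor_polydisk n r)"
    by (rule ring.is_abelian_group[OF ring_taylor_polydisk])
qed (auto simp: taylor_polydisk_def free_series_def ring_of_type_algebra_def norm_mult distrib_left distrib_right
    mult.assoc intro: summable_on_cmult_right)

lemma taylor_polydisk_smult_mult:
  assumes "f \<in> carrier (taylor_polydisk n r)" "g \<in> carrier (taylor_polydisk n r)"
  shows "(c \<odot>\<^bsub>taylor_polydisk n r\<^esub> f) \<otimes>\<^bsub>taylor_polydisk n r\<^esub> g =
      c \<odot>\<^bsub>taylor_polydisk n r\<^esub> (f \<otimes>\<^bsub>taylor_polydisk n r\<^esub> g)"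
    and "f \<otimes>\<^bsub>taylor_polydisk n r\<^esub> (c \<odot>\<^bsub>taylor_polydisk n r\<^esub> g) =
      c \<odot>\<^bsub>taylor_polydisk n r\<^esub> (f \<otimes>\<^bsub>taylor_polydisk n r\<^esub> g)"
  by (simp_all add: taylor_polydisk_def free_series_def case_prod_beta sum_distrib_left mult_ac)

lemma free_norm_mult_le:
  assumes "f \<in> carrier (taylor_polydisk n r)" "g \<in> carrier (taylor_polydisk n r)" "\<rho> \<in> radii r"
  shows "free_norm n \<rho> (f \<otimes>\<^bsub>taylor_polydisk n r\<^esub> g) \<le> free_norm n \<rho> f * free_norm n \<rho> g"
  unfolding free_mult_eq_conv[OF assms(1,2)] free_norm_def
  by (rule free.conv_norm(2))
    (use assms in \<open>auto simp: taylor_polydisk_def radii_def power_add\<close>)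


subsection \<open>The quantum polydisk algebra\<close>

lemma q_exponent_add_left: "q_exponent n (\<lambda>i. k i + k' i) l = q_exponent n k l + q_exponent n k' l"
  by (simp add: q_exponent_def sum.distrib distrib_right)

lemma q_exponent_add_right: "q_exponent n k (\<lambda>i. l i + l' i) = q_exponent n k l + q_exponent n k l'"
  by (simp add: q_exponent_def sum.distrib distrib_left)

lemma q_weight_q_exponent: "q_weight q n k = min (norm q ^ q_exponent n k k) 1"
  by (simp add: q_weight_def q_exponent_def mult.commute)

lemma finite_multi_index_splits:
  "finite {(k, l). k \<in> multi_indices n \<and> l \<in> multi_indices n \<and> (\<lambda>i. k i + l i) = m}"
proof (rule finite_subset)
  let ?A = "{k. \<forall>i. (i \<in> {1..n} \<longrightarrow> k i \<in> {..\<Sum>i=1..n. m i}) \<and> (i \<notin> {1..n} \<longrightarrow> k i = 0)}"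
  have "k i \<le> (\<Sum>i=1..n. k i + l i)" if "i \<in> {1..n}" for i and k l :: "nat \<Rightarrow> nat"
    using member_le_sum[of i "{1..n}" "\<lambda>i. k i + l i"] that by auto
  moreover have "l i \<le> (\<Sum>i=1..n. k i + l i)" if "i \<in> {1..n}" for i and k l :: "nat \<Rightarrow> nat"
    using member_le_sum[of i "{1..n}" "\<lambda>i. k i + l i"] that by auto
  ultimately show "{(k, l). k \<in> multi_indices n \<and> l \<in> multi_indices n \<and> (\<lambda>i. k i + l i) = m} \<subseteq> ?A \<times> ?A"
    by (auto simp: multi_indices_def)
  have "finite ?A" by (rule finite_set_of_finite_funs) auto
  then show "finite (?A \<times> ?A)" by blast
qed

interpretation quantum: twisted_convolution "multi_indices n" "\<lambda>k l i. k i + l i" "\<lambda>_. 0"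
  "\<lambda>k l. inverse q ^ q_exponent n k l" for n q
proof unfold_locales
  show "finite {(k, l). k \<in> multi_indices n \<and> l \<in> multi_indices n \<and> (\<lambda>i. k i + l i) = m}" for m
    by (rule finite_multi_index_splits)
  show "inverse q ^ q_exponent n k (\<lambda>_. 0) = 1" and "inverse q ^ q_exponent n (\<lambda>_. 0) k = 1" for k
    by (simp_all add: q_exponent_def)
  show "inverse q ^ q_exponent n k l * inverse q ^ q_exponent n (\<lambda>i. k i + l i) m =
      inverse q ^ q_exponent n l m * inverse q ^ q_exponent n k (\<lambda>i. l i + m i)" for k l m
    by (simp add: q_exponent_add_left q_exponent_add_right power_add)
qed (auto simp: multi_indices_def add.assoc)

lemma quantum_mult_eq_conv: "quantum_mult q n = quantum.conv n q"
  by (simp add: fun_eq_iff quantum_mult_def quantum.conv_def quantum.fibre_def)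

lemma q_weight_mult_le:
  assumes "q \<noteq> 0"
  shows "norm (inverse q ^ q_exponent n k l) * q_weight q n (\<lambda>i. k i + l i) \<le> q_weight q n k * q_weight q n l"
proof (cases "norm q \<le> 1")
  case True
  have le1: "norm q ^ m \<le> 1" for m using True by (simp add: power_le_one)
  have inv: "norm (inverse q ^ q_exponent n k l) * norm q ^ q_exponent n k l = 1"
    using assms by (simp add: norm_power norm_inverse flip: power_mult_distrib)
  have w: "q_weight q n m = norm q ^ q_exponent n m m" for m
    by (simp add: q_weight_q_exponent le1 min_absorb1)
  have "norm (inverse q ^ q_exponent n k l) * q_weight q n (\<lambda>i. k i + l i) =
      (norm (inverse q ^ q_exponent n k l) * norm q ^ q_exponent n k l) *
      (norm q ^ q_exponent n k k * norm q ^ q_exponent n l l * norm q ^ q_exponent n l k)"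
    by (simp only: w q_exponent_add_left q_exponent_add_right power_add mult_ac)
  also have "\<dots> = norm q ^ q_exponent n k k * norm q ^ q_exponent n l l * norm q ^ q_exponent n l k"
    by (simp only: inv mult_1)
  also have "\<dots> \<le> norm q ^ q_exponent n k k * norm q ^ q_exponent n l l"
    using le1 by (simp add: mult_left_le)
  finally show ?thesis by (simp only: w)
next
  case False
  then have "1 \<le> norm q ^ m" for m by (simp add: one_le_power)
  then show ?thesis using False
    by (simp add: q_weight_q_exponent min_absorb2 norm_power norm_inverse power_le_one inverse_le_1_iff)
qed

lemma q_weight_nonneg: "0 \<le> q_weight q n k"
  by (simp add: q_weight_def)

lemma quantum_weight_mult_le:
  assumes "q \<noteq> 0" "0 < \<rho>"
  shows "norm (inverse q ^ q_exponent n k l) *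
      (q_weight q n (\<lambda>i. k i + l i) * \<rho> ^ mi_size n (\<lambda>i. k i + l i)) \<le>
    q_weight q n k * \<rho> ^ mi_size n k * (q_weight q n l * \<rho> ^ mi_size n l)"
  using mult_right_mono[OF q_weight_mult_le[OF assms(1)], of "\<rho> ^ mi_size n k * \<rho> ^ mi_size n l"] assms(2)
  by (simp add: mi_size_def sum.distrib power_add mult_ac)

lemma ring_quantum_polydisk:
  assumes "q \<noteq> 0"
  shows "ring (quantum_polydisk q n r)"
proof (rule quantum.ring_conv[where n = n and q = q and
      W = "(\<lambda>\<rho> k. q_weight q n k * \<rho> ^ mi_size n k) ` radii r"])
  show "carrier (quantum_polydisk q n r) = {f. quantum.supp_on n f \<and>
      (\<forall>w\<in>(\<lambda>\<rho> k. q_weight q n k * \<rho> ^ mi_size n k) ` radii r.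
         (\<lambda>k. norm (f k) * w k) summable_on multi_indices n)}"
    by (auto simp: quantum_polydisk_def quantum.supp_on_def mult.assoc)
qed (use assms quantum_weight_mult_le in
    \<open>auto simp: quantum_polydisk_def quantum_mult_eq_conv radii_def q_weight_nonneg monom_series_def\<close>)

lemma module_quantum_polydisk:
  assumes "q \<noteq> 0"
  shows "module complex_ring (quantum_polydisk q n r)"
proof (rule moduleI)
  show "cring complex_ring" ..
  show "abelian_group (quantum_polydisk q n r)"
    by (rule ring.is_abelian_group[OF ring_quantum_polydisk[OF assms]])
qed (auto simp: quantum_polydisk_def ring_of_type_algebra_def norm_mult distrib_left distrib_right
    mult.assoc intro: summable_on_cmult_right)

lemma quantum_polydisk_smult_mult:
  "(c \<odot>\<^bsub>quantum_polydisk q n r\<^esub> f) \<otimes>\<^bsub>quantum_polydisk q n r\<^esub> g =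
    c \<odot>\<^bsub>quantum_polydisk q n r\<^esub> (f \<otimes>\<^bsub>quantum_polydisk q n r\<^esub> g)"
  "f \<otimes>\<^bsub>quantum_polydisk q n r\<^esub> (c \<odot>\<^bsub>quantum_polydisk q n r\<^esub> g) =
    c \<odot>\<^bsub>quantum_polydisk q n r\<^esub> (f \<otimes>\<^bsub>quantum_polydisk q n r\<^esub> g)"
  by (simp_all add: quantum_polydisk_def quantum_mult_eq_conv quantum.conv_scale_left
      quantum.conv_scale_right)

lemma quantum_norm_mult_le:
  assumes "q \<noteq> 0" and "f \<in> carrier (quantum_polydisk q n r)" "g \<in> carrier (quantum_polydisk q n r)"
    and "\<rho> \<in> radii r"
  shows "quantum_norm q n \<rho> (f \<otimes>\<^bsub>quantum_polydisk q n r\<^esub> g) \<le> quantum_norm q n \<rho> f * quantum_norm q n \<rho> g"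
proof -
  have "quantum_norm q n \<rho> (quantum.conv n q f g) \<le> quantum_norm q n \<rho> f * quantum_norm q n \<rho> g"
    unfolding quantum_norm_def mult.assoc
    by (rule quantum.conv_norm(2))
      (use assms quantum_weight_mult_le in
        \<open>auto simp: quantum_polydisk_def radii_def q_weight_nonneg mult.assoc\<close>)
  then show ?thesis by (simp add: quantum_polydisk_def quantum_mult_eq_conv)
qed

lemma monom_series_mult:
  assumes "k \<in> multi_indices n" "l \<in> multi_indices n"
  shows "monom_series k \<otimes>\<^bsub>quantum_polydisk q n r\<^esub> monom_series l =
    inverse q ^ q_exponent n k l \<odot>\<^bsub>quantum_polydisk q n r\<^esub> monom_series (\<lambda>i. k i + l i)"
  using quantum.conv_single[OF assms, of q]
  by (auto simp: quantum_polydisk_def quantum_mult_eq_conv monom_series_def fun_eq_iff)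

text \<open>The defining relations.\<close>

lemma quantum_gen_commute:
  assumes "q \<noteq> 0" and "1 \<le> i" "i < j" "j \<le> n"
  shows "quantum_gen i \<otimes>\<^bsub>quantum_polydisk q n r\<^esub> quantum_gen j =
    q \<odot>\<^bsub>quantum_polydisk q n r\<^esub> (quantum_gen j \<otimes>\<^bsub>quantum_polydisk q n r\<^esub> quantum_gen i)"
proof -
  let ?d = "\<lambda>i j :: nat. if j = i then 1 else 0 :: nat"
  have e: "q_exponent n (?d a) (?d b) = (if b < a then 1 else 0)" if "a \<in> {1..n}" "b \<in> {1..n}" for a b
  proof -
    have "q_exponent n (?d a) (?d b) = (\<Sum>j=1..n. if j = a then (\<Sum>i=1..<j. ?d b i) else 0)"
      unfolding q_exponent_def by (intro sum.cong) auto
    then show ?thesis using that by simp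
  qed
  have "?d a \<in> multi_indices n" if "a \<in> {1..n}" for a
    using that by (auto simp: multi_indices_def)
  then show ?thesis
    using assms unfolding quantum_gen_def
    by (simp add: monom_series_mult e)
      (auto simp: quantum_polydisk_def monom_series_def fun_eq_iff add.commute)
qed

text \<open>The basis element of index \<open>k\<close> is the ordered product of the powers of the generators.\<close>

lemma quantum_gen_pow:
  assumes "i \<in> {1..n}"
  shows "quantum_gen i [^]\<^bsub>quantum_polydisk q n r\<^esub> a = monom_series (\<lambda>j. if j = i then a else 0)"
proof (induction a)
  case 0
  show ?case by (simp add: nat_pow_def quantum_polydisk_def)
next
  case (Suc a)
  have "(\<lambda>j. if j = i then b else 0) \<in> multi_indices n" for b
    using assms by (auto simp: multi_indices_def)
  moreover have "q_exponent n (\<lambda>j. if j = i then a else 0) (\<lambda>j. if j = i then 1 else 0) = 0"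
    by (auto simp: q_exponent_def)
  moreover have "(\<lambda>j. (if j = i then a else 0) + (if j = i then 1 else 0)) =
      (\<lambda>j. if j = i then Suc a else 0)"
    by auto
  ultimately show ?case
    using Suc.IH
    by (simp add: nat_pow_def quantum_gen_def monom_series_mult)
      (simp add: quantum_polydisk_def)
qed

lemma monom_series_eq_ordered_product:
  assumes "k \<in> multi_indices n"
  shows "monom_series k =
    foldr (\<lambda>i f. quantum_gen i [^]\<^bsub>quantum_polydisk q n r\<^esub> k i \<otimes>\<^bsub>quantum_polydisk q n r\<^esub> f)
      [1..<Suc n] \<one>\<^bsub>quantum_polydisk q n r\<^esub>"
proof -
  let ?A = "quantum_polydisk q n r"
  have "foldr (\<lambda>i f. quantum_gen i [^]\<^bsub>?A\<^esub> k i \<otimes>\<^bsub>?A\<^esub> f) [m..<Suc n] \<one>\<^bsub>?A\<^esub> =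
      monom_series (\<lambda>i. if m \<le> i then k i else 0)" if "1 \<le> m" "m \<le> Suc n" for m
    using that
  proof (induction "Suc n - m" arbitrary: m)
    case 0
    then have "m = Suc n" by simp
    moreover have "(\<lambda>i. if Suc n \<le> i then k i else 0) = (\<lambda>i. 0)"
      using assms by (auto simp: multi_indices_def)
    ultimately show ?case by (simp add: quantum_polydisk_def)
  next
    case (Suc d)
    then have m: "m \<in> {1..n}" by auto
    have eq: "(\<lambda>j. (if j = m then k m else 0) + (if Suc m \<le> j then k j else 0)) =
        (\<lambda>j. if m \<le> j then k j else 0)"
      by (rule ext) (simp add: Suc_le_eq le_less)
    have "q_exponent n (\<lambda>j. if j = m then k m else 0) (\<lambda>j. if Suc m \<le> j then k j else 0) = 0"
      by (auto simp: q_exponent_def)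
    moreover have "(\<lambda>j. if j = m then k m else 0) \<in> multi_indices n"
      "(\<lambda>j. if Suc m \<le> j then k j else 0) \<in> multi_indices n"
      using m assms by (auto simp: multi_indices_def)
    ultimately have "monom_series (\<lambda>j. if j = m then k m else 0) \<otimes>\<^bsub>?A\<^esub>
        monom_series (\<lambda>j. if Suc m \<le> j then k j else 0) = monom_series (\<lambda>j. if m \<le> j then k j else 0)"
      by (simp add: monom_series_mult eq) (simp add: quantum_polydisk_def)
    moreover have "[m..<Suc n] = m # [Suc m..<Suc n]"
      using m by (simp add: upt_conv_Cons)
    ultimately show ?case
      using Suc.hyps(1)[of "Suc m"] Suc.hyps(2) m
      by (simp add: quantum_gen_pow[OF m])
  qed
  from this[of 1] show ?thesis
    using assms by (simp add: multi_indices_def)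
      (metis (no_types, lifting) One_nat_def ext not_less_eq_eq less_one not_le)
qed

end

theory Submission
  imports Defs
begin

text \<open>The projection \<open>\<pi>\<close> sends \<open>\<zeta>\<^sub>\<alpha>\<close> to \<open>q\<^sup>-\<^sup>m x\<^sup>k\<close>, where \<open>m\<close> is the number of inversions of \<open>\<alpha>\<close> and \<open>k\<close>
  counts its letters. It has a linear section \<open>\<sigma>\<close> that sends \<open>x\<^sup>k\<close> to a scalar multiple of a single word: the
  increasing one if \<open>\<bar>q\<bar> \<ge> 1\<close>, the decreasing one, which has the maximal number \<open>\<Sum>\<^sub>i\<^sub><\<^sub>j k\<^sub>i k\<^sub>j\<close> of
  inversions, if \<open>\<bar>q\<bar> < 1\<close>. The weight \<open>w\<^sub>q\<close> is exactly what makes \<open>\<sigma>\<close> isometric and \<open>\<pi>\<close> contractive for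
  every \<open>\<rho>\<close>, so the quotient norm is attained on the image of \<open>\<sigma>\<close>, and \<open>\<sigma> \<circ> \<pi>\<close> is a continuous
  projection with kernel \<open>Ker \<pi>\<close>. Every closed ideal containing the relations contains
  \<open>\<zeta>\<^sub>\<alpha> - \<sigma> (\<pi> \<zeta>\<^sub>\<alpha>)\<close> for each word (bubble sort), hence, by continuity, \<open>f - \<sigma> (\<pi> f)\<close> for every \<open>f\<close>,
  which is \<open>f\<close> itself if \<open>\<pi> f = 0\<close>.\<close>

section \<open>Topologies defined by families of norms\<close>

text \<open>Subtraction is the one axiomatised operation: negation is \<open>0 - f\<close> and
  addition is \<open>f - (-g)\<close>, with norm bounds obtained the same way. Each single
  \<open>N \<rho>\<close> is definite on \<open>A\<close>, so one radius is enough to separate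
  points.\<close>

locale norm_family =
  fixes A :: "('a \<Rightarrow> complex) set" and N :: "real \<Rightarrow> ('a \<Rightarrow> complex) \<Rightarrow> real" and R :: "real set"
  assumes R_nonempty: "R \<noteq> {}"
    and zero_closed: "(\<lambda>_. 0) \<in> A"
    and diff_closed: "f \<in> A \<Longrightarrow> g \<in> A \<Longrightarrow> (\<lambda>a. f a - g a) \<in> A"
    and N_diff: "\<rho> \<in> R \<Longrightarrow> f \<in> A \<Longrightarrow> g \<in> A \<Longrightarrow> N \<rho> (\<lambda>a. f a - g a) \<le> N \<rho> f + N \<rho> g"
    and N_zero: "N \<rho> (\<lambda>_. 0) = 0"
    and N_pos: "\<rho> \<in> R \<Longrightarrow> f \<in> A \<Longrightarrow> f \<noteq> (\<lambda>_. 0) \<Longrightarrow> 0 < N \<rho> f"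
begin

abbreviation T :: "('a \<Rightarrow> complex) topology" where
  "T \<equiv> norm_family_topology A N R"

lemma N_nonneg: "\<rho> \<in> R \<Longrightarrow> f \<in> A \<Longrightarrow> 0 \<le> N \<rho> f"
  using N_pos[of \<rho> f] N_zero[of \<rho>] by fastforce

lemma uminus_closed: "f \<in> A \<Longrightarrow> (\<lambda>a. - f a) \<in> A"
  using diff_closed[OF zero_closed, of f] by simp

lemma add_closed: "f \<in> A \<Longrightarrow> g \<in> A \<Longrightarrow> (\<lambda>a. f a + g a) \<in> A"
  using diff_closed[OF _ uminus_closed, of f g] by simp

lemma N_uminus_le: "\<rho> \<in> R \<Longrightarrow> f \<in> A \<Longrightarrow> N \<rho> (\<lambda>a. - f a) \<le> N \<rho> f"
  using N_diff[OF _ zero_closed, of \<rho> f] by (simp add: N_zero)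

lemma N_add: "\<rho> \<in> R \<Longrightarrow> f \<in> A \<Longrightarrow> g \<in> A \<Longrightarrow> N \<rho> (\<lambda>a. f a + g a) \<le> N \<rho> f + N \<rho> g"
  using N_diff[OF _ _ uminus_closed, of \<rho> f g] N_uminus_le[of \<rho> g] by simp

lemma N_triangle:
  assumes "\<rho> \<in> R" "f \<in> A" "g \<in> A" "h \<in> A"
  shows "N \<rho> (\<lambda>a. f a - h a) \<le> N \<rho> (\<lambda>a. f a - g a) + N \<rho> (\<lambda>a. g a - h a)"
  using N_add[OF assms(1) diff_closed diff_closed, OF assms(2,3,3,4)] by simp

lemma openin_ball:
  assumes "f \<in> A" "\<rho> \<in> R" "0 < \<epsilon>"
  shows "openin T {g \<in> A. N \<rho> (\<lambda>a. g a - f a) < \<epsilon>}"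
  unfolding norm_family_topology_def
  by (rule topology_generated_by_Basis) (use assms in blast)

lemma topspace_T [simp]: "topspace T = A"
proof -
  obtain \<rho> where \<rho>: "\<rho> \<in> R" using R_nonempty by blast
  have "A \<subseteq> topspace T"
  proof
    fix f assume f: "f \<in> A"
    have "f \<in> {g \<in> A. N \<rho> (\<lambda>a. g a - f a) < 1}"
      using f by (simp add: N_zero)
    then show "f \<in> topspace T"
      using openin_subset[OF openin_ball[OF f \<rho>, of 1]] by auto
  qed
  then show ?thesis
    by (auto simp: norm_family_topology_def)
qed

section \<open>Criteria for continuity, convergence and closedness\<close>

text \<open>The balls are only a subbase, so preimages of balls with arbitrary centre
  \<open>f\<close> must be tested. The slack between \<open>h x\<close> and the boundary of such a
  ball serves as the tolerance in the assumed estimate around \<open>h x\<close>.\<close>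

lemma continuous_map_into:
  assumes "\<And>x. x \<in> topspace Z \<Longrightarrow> h x \<in> A"
    and "\<And>x \<rho> \<epsilon>. x \<in> topspace Z \<Longrightarrow> \<rho> \<in> R \<Longrightarrow> 0 < \<epsilon> \<Longrightarrow>
      \<exists>U. openin Z U \<and> x \<in> U \<and> (\<forall>y\<in>U. N \<rho> (\<lambda>a. h y a - h x a) < \<epsilon>)"
  shows "continuous_map Z T h"
  unfolding norm_family_topology_def continuous_on_generated_topo_iff
  \<comment> \<open>The union of the subbase is folded back into \<open>topspace T\<close>, which
    \<open>topspace_T\<close> identifies with \<open>A\<close>.\<close>
  unfolding topology_generated_by_topspace[symmetric] norm_family_topology_def[symmetric]
proof (intro conjI allI impI)
  show "h ` topspace Z \<subseteq> topspace T"
    using assms(1) by auto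
  fix B assume "B \<in> {{g \<in> A. N \<rho> (\<lambda>a. g a - f a) < \<epsilon>} |f \<rho> \<epsilon>. f \<in> A \<and> \<rho> \<in> R \<and> 0 < \<epsilon>}"
  then obtain f \<rho> \<epsilon> where B: "B = {g \<in> A. N \<rho> (\<lambda>a. g a - f a) < \<epsilon>}" and f: "f \<in> A" and \<rho>: "\<rho> \<in> R"
    by blast
  show "openin Z (h -` B \<inter> topspace Z)"
  proof (subst openin_subopen, intro ballI)
    fix x assume "x \<in> h -` B \<inter> topspace Z"
    then have x: "x \<in> topspace Z" "h x \<in> A" "0 < \<epsilon> - N \<rho> (\<lambda>a. h x a - f a)"
      by (auto simp: B)
    obtain U where U: "openin Z U" "x \<in> U"
      "\<And>y. y \<in> U \<Longrightarrow> N \<rho> (\<lambda>a. h y a - h x a) < \<epsilon> - N \<rho> (\<lambda>a. h x a - f a)"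
      using assms(2)[OF x(1) \<rho> x(3)] by blast
    have "U \<subseteq> h -` B \<inter> topspace Z"
    proof
      fix y assume y: "y \<in> U"
      then have yX: "y \<in> topspace Z" using openin_subset[OF U(1)] by blast
      have "N \<rho> (\<lambda>a. h y a - f a) < \<epsilon>"
        using N_triangle[OF \<rho> assms(1)[OF yX] x(2) f] U(3)[OF y] by simp
      then show "y \<in> h -` B \<inter> topspace Z"
        using yX assms(1) by (simp add: B)
    qed
    then show "\<exists>T. openin Z T \<and> x \<in> T \<and> T \<subseteq> h -` B \<inter> topspace Z"
      using U by blast
  qed
qed

text \<open>Induction over the generation of open sets: eventual membership passes to finite
  intersections and to unions, so only subbasic balls need an estimate, and there the triangle
  inequality through \<open>l\<close> applies.\<close>

lemma limitin_T:
  assumes l: "l \<in> A" and g: "\<And>i. g i \<in> A"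
    and lim: "\<And>\<rho>. \<rho> \<in> R \<Longrightarrow> ((\<lambda>i. N \<rho> (\<lambda>a. g i a - l a)) \<longlongrightarrow> 0) F"
  shows "limitin T g l F"
  unfolding limitin_def
proof (intro conjI allI impI)
  show "l \<in> topspace T" using l by simp
  fix U assume "openin T U \<and> l \<in> U"
  then have "generate_topology_on {{g \<in> A. N \<rho> (\<lambda>a. g a - f a) < \<epsilon>} |f \<rho> \<epsilon>. f \<in> A \<and> \<rho> \<in> R \<and> 0 < \<epsilon>} U"
    and "l \<in> U"
    by (auto simp: norm_family_topology_def openin_topology_generated_by_iff)
  then show "\<forall>\<^sub>F i in F. g i \<in> U"
  proof induction
    case (UN K)
    then obtain k where "k \<in> K" "l \<in> k" by blast
    then show ?case
      using UN.IH[of k] by (auto elim: eventually_mono)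
  next
    case (Basis s)
    then obtain f \<rho> \<epsilon> where s: "s = {g \<in> A. N \<rho> (\<lambda>a. g a - f a) < \<epsilon>}" and f: "f \<in> A" and \<rho>: "\<rho> \<in> R"
      by blast
    then have "0 < \<epsilon> - N \<rho> (\<lambda>a. l a - f a)" using Basis by simp
    then have "\<forall>\<^sub>F i in F. N \<rho> (\<lambda>a. g i a - l a) < \<epsilon> - N \<rho> (\<lambda>a. l a - f a)"
      by (rule order_tendstoD(2)[OF lim[OF \<rho>]])
    then show ?case
    proof eventually_elim
      case (elim i)
      then show ?case
        using N_triangle[OF \<rho> g[of i] l f] g by (simp add: s)
    qed
  qed (auto intro: eventually_conj)
qed

text \<open>The ball around \<open>f\<close> of radius \<open>N \<rho> f\<close> misses zero, since
  the norm of \<open>-f\<close> is at least that of \<open>f\<close>.\<close>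

lemma closedin_zero: "closedin T {\<lambda>_. 0}"
proof -
  obtain \<rho> where \<rho>: "\<rho> \<in> R" using R_nonempty by blast
  have "openin T (A - {\<lambda>_. 0})"
  proof (subst openin_subopen, intro ballI)
    fix f assume f: "f \<in> A - {\<lambda>_. 0}"
    let ?B = "{g \<in> A. N \<rho> (\<lambda>a. g a - f a) < N \<rho> f}"
    have pos: "0 < N \<rho> f" using f N_pos[OF \<rho>] by blast
    have "N \<rho> f \<le> N \<rho> (\<lambda>a. - f a)"
      using N_uminus_le[OF \<rho> uminus_closed, of f] f by simp
    then have "?B \<subseteq> A - {\<lambda>_. 0}" by auto
    moreover have "f \<in> ?B" using f pos by (simp add: N_zero)
    moreover have "openin T ?B" using openin_ball[OF _ \<rho> pos] f by blast
    ultimately show "\<exists>U. openin T U \<and> f \<in> U \<and> U \<subseteq> A - {\<lambda>_. 0}" by blast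
  qed
  then show ?thesis using zero_closed by (simp add: closedin_def)
qed

lemma continuous_map_add: "continuous_map (prod_topology T T) T (\<lambda>(f, g) a. f a + g a)"
proof (rule continuous_map_into, goal_cases)
  case (1 x)
  then show ?case by (auto intro: add_closed)
next
  case (2 x \<rho> \<epsilon>)
  obtain f g where x: "x = (f, g)" by force
  have fg: "f \<in> A" "g \<in> A" using 2 by (auto simp: x)
  let ?B = "\<lambda>f. {h \<in> A. N \<rho> (\<lambda>a. h a - f a) < \<epsilon> / 2}"
  have "N \<rho> (\<lambda>a. (f' a + g' a) - (f a + g a)) < \<epsilon>" if "f' \<in> ?B f" "g' \<in> ?B g" for f' g'
    using that N_add[OF 2(2) diff_closed diff_closed, of f' f g' g] fg
    by (simp add: algebra_simps)
  then have "\<forall>y\<in>?B f \<times> ?B g. N \<rho> (\<lambda>a. (case y of (f, g) \<Rightarrow> \<lambda>a. f a + g a) a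
      - (case x of (f, g) \<Rightarrow> \<lambda>a. f a + g a) a) < \<epsilon>"
    unfolding x by auto
  moreover have "openin (prod_topology T T) (?B f \<times> ?B g)"
    using openin_ball[OF fg(1) 2(2), of "\<epsilon> / 2"] openin_ball[OF fg(2) 2(2), of "\<epsilon> / 2"] 2(3)
    by (auto simp: openin_prod_Times_iff)
  moreover have "x \<in> ?B f \<times> ?B g"
    using fg 2(3) by (simp add: x N_zero)
  ultimately show ?case by blast
qed

lemma continuous_map_bounded:
  assumes "norm_family B M R"
    and closed: "\<And>f. f \<in> A \<Longrightarrow> h f \<in> B"
    and diff: "\<And>f g. f \<in> A \<Longrightarrow> g \<in> A \<Longrightarrow> h (\<lambda>a. f a - g a) = (\<lambda>b. h f b - h g b)"
    and bound: "\<And>\<rho> f. \<rho> \<in> R \<Longrightarrow> f \<in> A \<Longrightarrow> M \<rho> (h f) \<le> C * N \<rho> f"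
  shows "continuous_map T (norm_family_topology B M R) h"
proof -
  interpret B: norm_family B M R by fact
  show ?thesis
  proof (rule B.continuous_map_into)
    show "h f \<in> B" if "f \<in> topspace T" for f
      using closed that by simp
    fix f and \<rho> \<epsilon> :: real
    assume "f \<in> topspace T" and \<rho>: "\<rho> \<in> R" and \<epsilon>: "0 < \<epsilon>"
    then have f: "f \<in> A" by simp
    \<comment> \<open>\<open>C\<close> may be zero or negative; \<open>?D\<close> is a positive
      bound that can be divided by.\<close>
    let ?D = "max C 1"
    let ?U = "{g \<in> A. N \<rho> (\<lambda>a. g a - f a) < \<epsilon> / ?D}"
    have "M \<rho> (\<lambda>b. h g b - h f b) < \<epsilon>" if g: "g \<in> ?U" for g
    proof -
      have "M \<rho> (\<lambda>b. h g b - h f b) \<le> C * N \<rho> (\<lambda>a. g a - f a)"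
        using bound[OF \<rho> diff_closed, of g f] diff[of g f] f g by simp
      also have "\<dots> \<le> ?D * N \<rho> (\<lambda>a. g a - f a)"
        using N_nonneg[OF \<rho> diff_closed, of g f] f g by (intro mult_right_mono) auto
      also have "\<dots> < \<epsilon>"
        using g by (simp add: pos_less_divide_eq mult.commute)
      finally show ?thesis .
    qed
    moreover have "openin T ?U" using \<epsilon> by (intro openin_ball f \<rho>) simp
    moreover have "f \<in> ?U" using f \<epsilon> by (simp add: N_zero)
    ultimately show "\<exists>U. openin T U \<and> f \<in> U \<and> (\<forall>g\<in>U. M \<rho> (\<lambda>b. h g b - h f b) < \<epsilon>)" by blast
  qed
qed

text \<open>A bounded idempotent \<open>P\<close> splits the space: addition has the inverse sending
  \<open>f\<close> to the pair of \<open>f - P f\<close> and \<open>P f\<close>, and both components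
  are continuous because they are bounded in each norm.\<close>

lemma projection_complement:
  assumes closed: "\<And>f. f \<in> A \<Longrightarrow> P f \<in> A"
    and diff: "\<And>f g. f \<in> A \<Longrightarrow> g \<in> A \<Longrightarrow> P (\<lambda>a. f a - g a) = (\<lambda>a. P f a - P g a)"
    and bound: "\<And>\<rho> f. \<rho> \<in> R \<Longrightarrow> f \<in> A \<Longrightarrow> N \<rho> (P f) \<le> C * N \<rho> f"
    and idem: "\<And>f. f \<in> A \<Longrightarrow> P (P f) = P f"
  shows "closedin T {f \<in> A. P f = (\<lambda>_. 0)}" and "closedin T {f \<in> A. P f = f}"
    and "homeomorphic_map
      (prod_topology (subtopology T {f \<in> A. P f = (\<lambda>_. 0)}) (subtopology T {f \<in> A. P f = f})) T
      (\<lambda>(f, g) a. f a + g a)"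
proof -
  let ?K = "{f \<in> A. P f = (\<lambda>_. 0)}" and ?L = "{f \<in> A. P f = f}"
  let ?Q = "\<lambda>f a. f a - P f a"
  have fam: "norm_family A N R" by unfold_locales
  have P: "continuous_map T T P"
    by (rule continuous_map_bounded[OF fam closed diff bound])
  have Q: "continuous_map T T ?Q"
  proof (rule continuous_map_bounded[OF fam])
    show "N \<rho> (?Q f) \<le> (1 + C) * N \<rho> f" if "\<rho> \<in> R" "f \<in> A" for \<rho> f
      using N_diff[OF that(1,2) closed[OF that(2)]] bound[OF that] by (simp add: algebra_simps)
  qed (auto simp: closed diff diff_closed fun_eq_iff)
  show "closedin T ?K"
    using closedin_continuous_map_preimage[OF P closedin_zero] by simp
  \<comment> \<open>The fixed points of \<open>P\<close> are the zeros of \<open>?Q\<close>, hence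
    closed for the same reason as the kernel.\<close>
  have "?L = {f \<in> topspace T. ?Q f \<in> {\<lambda>_. 0}}"
    by (auto simp: fun_eq_iff)
  then show "closedin T ?L"
    using closedin_continuous_map_preimage[OF Q closedin_zero] by simp
  have P0: "P (?Q f) = (\<lambda>_. 0)" if "f \<in> A" for f
    using diff[OF that closed[OF that]] idem[OF that] by simp
  \<comment> \<open>Only compatibility of \<open>P\<close> with differences is assumed, so the sum
    is treated as the difference of \<open>f\<close> and \<open>-g\<close>.\<close>
  have Padd: "P (\<lambda>a. f a + g a) = g" if "f \<in> ?K" "g \<in> ?L" for f g
  proof -
    have "P (\<lambda>a. - g a) = (\<lambda>a. - P g a)"
      using diff[OF zero_closed, of g] diff[OF zero_closed zero_closed] that by simp
    then show ?thesis
      using diff[of f "\<lambda>a. - g a"] that uminus_closed[of g] by simp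
  qed
  have "homeomorphic_maps (prod_topology (subtopology T ?K) (subtopology T ?L)) T
      (\<lambda>(f, g) a. f a + g a) (\<lambda>f. (?Q f, P f))"
    unfolding homeomorphic_maps_def
  proof (intro conjI ballI)
    show "continuous_map (prod_topology (subtopology T ?K) (subtopology T ?L)) T (\<lambda>(f, g) a. f a + g a)"
      unfolding subtopology_Times[symmetric]
      by (rule continuous_map_from_subtopology[OF continuous_map_add])
    show "continuous_map T (prod_topology (subtopology T ?K) (subtopology T ?L)) (\<lambda>f. (?Q f, P f))"
      by (intro continuous_map_pairedI continuous_map_into_subtopology P Q)
        (auto simp: closed diff_closed P0 idem)
  next
    fix x assume x: "x \<in> topspace (prod_topology (subtopology T ?K) (subtopology T ?L))"
    then obtain f g where fg: "x = (f, g)" "f \<in> ?K" "g \<in> ?L" by auto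
    show "(\<lambda>f. (?Q f, P f)) ((\<lambda>(f, g) a. f a + g a) x) = x"
      using Padd[OF fg(2,3)] by (simp add: fg(1))
  qed simp
  then show "homeomorphic_map (prod_topology (subtopology T ?K) (subtopology T ?L)) T
      (\<lambda>(f, g) a. f a + g a)"
    by (auto simp: homeomorphic_map_maps)
qed

end

text \<open>Both polydisk algebras are intersections of weighted l1-spaces of this shape. Strict
  positivity of the weights makes each seminorm a norm: one nonzero coefficient already bounds it
  from below.\<close>

lemma norm_family_weighted:
  fixes w :: "real \<Rightarrow> 'a \<Rightarrow> real"
  assumes "R \<noteq> {}" and w: "\<And>\<rho> k. \<rho> \<in> R \<Longrightarrow> k \<in> S \<Longrightarrow> 0 < w \<rho> k"
  shows "norm_family {f. (\<forall>k. k \<notin> S \<longrightarrow> f k = 0) \<and> (\<forall>\<rho>\<in>R. (\<lambda>k. norm (f k) * w \<rho> k) summable_on S)}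
    (\<lambda>\<rho> f. \<Sum>\<^sub>\<infinity>k\<in>S. norm (f k) * w \<rho> k) R"
proof
  have le: "norm (f k - g k) * w \<rho> k \<le> norm (f k) * w \<rho> k + norm (g k) * w \<rho> k"
    if "\<rho> \<in> R" "k \<in> S" for \<rho> k and f g :: "'a \<Rightarrow> complex"
    using mult_right_mono[OF norm_triangle_ineq4[of "f k" "g k"], of "w \<rho> k"] w[OF that]
    by (simp add: distrib_right)
  have sum: "(\<lambda>k. norm (f k - g k) * w \<rho> k) summable_on S"
    if "\<rho> \<in> R" "(\<lambda>k. norm (f k) * w \<rho> k) summable_on S" "(\<lambda>k. norm (g k) * w \<rho> k) summable_on S"
    for \<rho> and f g :: "'a \<Rightarrow> complex"
    by (rule summable_on_comparison_test[OF summable_on_add[OF that(2,3)]])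
      (use le w that(1) in \<open>auto simp: less_imp_le\<close>)
  let ?A = "{f :: 'a \<Rightarrow> complex. (\<forall>k. k \<notin> S \<longrightarrow> f k = 0) \<and> (\<forall>\<rho>\<in>R. (\<lambda>k. norm (f k) * w \<rho> k) summable_on S)}"
  show "(\<lambda>a. f a - g a) \<in> ?A" if "f \<in> ?A" "g \<in> ?A" for f g
    using that sum by auto
  show "(\<Sum>\<^sub>\<infinity>k\<in>S. norm (f k - g k) * w \<rho> k) \<le>
      (\<Sum>\<^sub>\<infinity>k\<in>S. norm (f k) * w \<rho> k) + (\<Sum>\<^sub>\<infinity>k\<in>S. norm (g k) * w \<rho> k)"
    if "\<rho> \<in> R" "f \<in> ?A" "g \<in> ?A" for \<rho> f g
    using that le sum by (subst infsum_add[symmetric]) (auto intro!: infsum_mono summable_on_add)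
  show "0 < (\<Sum>\<^sub>\<infinity>k\<in>S. norm (f k) * w \<rho> k)" if \<rho>: "\<rho> \<in> R" and f: "f \<in> ?A" "f \<noteq> (\<lambda>_. 0)" for \<rho> f
  proof -
    obtain k where k: "f k \<noteq> 0" using f(2) by (meson ext)
    then have kS: "k \<in> S" using f by auto
    have "0 < norm (f k) * w \<rho> k" using k w[OF \<rho> kS] by simp
    also have "\<dots> = (\<Sum>\<^sub>\<infinity>k\<in>{k}. norm (f k) * w \<rho> k)" by simp
    also have "\<dots> \<le> (\<Sum>\<^sub>\<infinity>k\<in>S. norm (f k) * w \<rho> k)"
      using f \<rho> kS w[OF \<rho>] by (intro infsum_mono_neutral) (auto simp: less_imp_le)
    finally show ?thesis .
  qed
qed (use assms in auto)

section \<open>Words and inversions\<close>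

definition letter_count :: "nat list \<Rightarrow> nat \<Rightarrow> nat" where
  "letter_count \<alpha> = count_list \<alpha>"

text \<open>The exponent of \<open>inverse q\<close> picked up when a monomial is put into
  increasing order: each pair of letters out of order costs one exchange.\<close>

fun inversions :: "nat list \<Rightarrow> nat" where
  "inversions [] = 0"
| "inversions (a # \<alpha>) = length (filter (\<lambda>b. b < a) \<alpha>) + inversions \<alpha>"

lemma words_Nil [simp]: "[] \<in> words n"
  and words_Cons [simp]: "a # \<alpha> \<in> words n \<longleftrightarrow> a \<in> {1..n} \<and> \<alpha> \<in> words n"
  and words_append [simp]: "\<alpha> @ \<beta> \<in> words n \<longleftrightarrow> \<alpha> \<in> words n \<and> \<beta> \<in> words n"
  and words_rev [simp]: "rev \<alpha> \<in> words n \<longleftrightarrow> \<alpha> \<in> words n"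
  and words_sort [simp]: "sort \<alpha> \<in> words n \<longleftrightarrow> \<alpha> \<in> words n"
  by (auto simp: words_def in_lists_conv_set)

lemma letter_count_Nil: "letter_count [] = (\<lambda>_. 0)"
  by (simp add: letter_count_def fun_eq_iff)

lemma letter_count_single: "letter_count [a] = (\<lambda>i. if i = a then 1 else 0)"
  by (auto simp: letter_count_def fun_eq_iff)

lemma letter_count_append: "letter_count (\<alpha> @ \<beta>) = (\<lambda>i. letter_count \<alpha> i + letter_count \<beta> i)"
  by (simp add: letter_count_def fun_eq_iff)

lemma letter_count_eq_iff: "letter_count \<alpha> = letter_count \<beta> \<longleftrightarrow> mset \<alpha> = mset \<beta>"
  by (simp add: letter_count_def fun_eq_iff multiset_eq_iff count_mset)

lemma letter_count_multi_indices: "\<alpha> \<in> words n \<Longrightarrow> letter_count \<alpha> \<in> multi_indices n"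
  by (auto simp: letter_count_def multi_indices_def words_def in_lists_conv_set count_list_0_iff)

lemma mi_size_letter_count:
  assumes "\<alpha> \<in> words n"
  shows "mi_size n (letter_count \<alpha>) = length \<alpha>"
proof -
  have "(\<Sum>i\<in>set \<alpha>. count_list \<alpha> i) = (\<Sum>i\<in>{1..n}. count_list \<alpha> i)"
    by (rule sum.mono_neutral_left) (use assms in \<open>auto simp: words_def count_list_0_iff\<close>)
  then show ?thesis
    by (simp add: mi_size_def letter_count_def sum_count_set)
qed

lemma ex_sorted_word:
  assumes "k \<in> multi_indices n"
  obtains \<alpha> where "\<alpha> \<in> words n" "sorted \<alpha>" "letter_count \<alpha> = k"
proof
  \<comment> \<open>The word with \<open>k 1\<close> letters 1, then \<open>k 2\<close> letters 2,
    and so on; the outer \<open>sort\<close> gives sortedness at once and leaves the multiset of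
    letters alone.\<close>
  let ?\<alpha> = "sort (concat (map (\<lambda>i. replicate (k i) i) [1..<Suc n]))"
  show "?\<alpha> \<in> words n" and "sorted ?\<alpha>"
    by (auto simp: words_def in_lists_conv_set)
  have "count_list (replicate m i) j = (if j = i then m else 0)" for m i j :: nat
    by (induction m) auto
  then have "count (mset ?\<alpha>) j = k j" for j
    using assms by (auto simp: count_list_concat count_mset o_def sum_list_distinct_conv_sum_set multi_indices_def
        simp del: upt_Suc)
  then show "letter_count ?\<alpha> = k"
    by (simp add: letter_count_def fun_eq_iff flip: count_mset)
qed

text \<open>The letter counts fix the length, and a finite alphabet has finitely many words of given
  length. This keeps every coefficient of \<open>ordering_map\<close> a finite sum.\<close>

lemma finite_letter_count_fibre: "finite {\<alpha> \<in> words n. letter_count \<alpha> = k}"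
proof (rule finite_subset)
  show "{\<alpha> \<in> words n. letter_count \<alpha> = k} \<subseteq> {\<alpha>. set \<alpha> \<subseteq> {1..n} \<and> length \<alpha> = mi_size n k}"
    using mi_size_letter_count by (auto simp: words_def in_lists_conv_set)
qed (simp add: finite_lists_length_eq)

lemma q_exponent_single_left:
  assumes "a \<in> {1..n}"
  shows "q_exponent n (letter_count [a]) l = (\<Sum>i=1..<a. l i)"
proof -
  have "q_exponent n (letter_count [a]) l = (\<Sum>j=1..n. if j = a then (\<Sum>i=1..<j. l i) else 0)"
    unfolding q_exponent_def letter_count_single by (intro sum.cong) auto
  then show ?thesis using assms by simp
qed

lemma length_filter_less:
  assumes "\<alpha> \<in> words n"
  shows "length (filter (\<lambda>b. b < a) \<alpha>) = (\<Sum>i=1..<a. letter_count \<alpha> i)"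
  using assms
proof (induction \<alpha>)
  case (Cons b \<alpha>)
  have "letter_count (b # \<alpha>) = (\<lambda>i. (if i = b then 1 else 0) + letter_count \<alpha> i)"
    using letter_count_append[of "[b]" \<alpha>] by (simp add: letter_count_single)
  then show ?case
    using Cons by (auto simp: sum.distrib)
qed (simp add: letter_count_Nil)

text \<open>Expresses the contribution of the head through the bilinear \<open>q_exponent\<close>,
  so that the inductions below reduce to additivity.\<close>

lemma inversions_Cons:
  assumes "a \<in> {1..n}" "\<alpha> \<in> words n"
  shows "inversions (a # \<alpha>) = q_exponent n (letter_count [a]) (letter_count \<alpha>) + inversions \<alpha>"
  using assms by (simp add: q_exponent_single_left length_filter_less)

text \<open>The inversions between the two blocks depend only on their letter counts, and their
  number is the exponent in the cocycle of the quantum product. This is why the projection is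
  multiplicative.\<close>

lemma inversions_append:
  assumes "\<alpha> \<in> words n" "\<beta> \<in> words n"
  shows "inversions (\<alpha> @ \<beta>) = inversions \<alpha> + inversions \<beta> + q_exponent n (letter_count \<alpha>) (letter_count \<beta>)"
  using assms(1)
proof (induction \<alpha>)
  case Nil
  then show ?case by (simp add: letter_count_Nil q_exponent_def)
next
  case (Cons a \<alpha>)
  then have a: "a \<in> {1..n}" "\<alpha> \<in> words n" by auto
  have "q_exponent n (letter_count (a # \<alpha>)) k =
      q_exponent n (letter_count [a]) k + q_exponent n (letter_count \<alpha>) k" for k
    using letter_count_append[of "[a]" \<alpha>] by (simp add: q_exponent_add_left)
  then show ?case
    using Cons.IH[OF a(2)] assms(2) a
    by (simp only: append_Cons inversions_Cons[OF a] inversions_Cons[of a n "\<alpha> @ \<beta>"] words_append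
        letter_count_append q_exponent_add_right)
qed

text \<open>A pair of positions with distinct letters is an inversion of exactly one of the word and
  its reverse; pairs of equal letters contribute to neither.\<close>

lemma inversions_rev:
  assumes "\<alpha> \<in> words n"
  shows "inversions (rev \<alpha>) + inversions \<alpha> = q_exponent n (letter_count \<alpha>) (letter_count \<alpha>)"
  using assms
proof (induction \<alpha>)
  case Nil
  then show ?case by (simp add: letter_count_Nil q_exponent_def)
next
  case (Cons a \<alpha>)
  then have a: "a \<in> {1..n}" "\<alpha> \<in> words n" by auto
  have c: "letter_count (rev \<alpha>) = letter_count \<alpha>" by (simp add: letter_count_eq_iff)
  have "q_exponent n (letter_count [a]) (letter_count [a]) = 0"
    unfolding q_exponent_single_left[OF a(1)] by (simp add: letter_count_single)
  moreover have "letter_count (a # \<alpha>) = (\<lambda>i. letter_count [a] i + letter_count \<alpha> i)"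
    using letter_count_append[of "[a]" \<alpha>] by simp
  moreover have "inversions (rev \<alpha> @ [a]) =
      inversions (rev \<alpha>) + q_exponent n (letter_count \<alpha>) (letter_count [a])"
    using inversions_append[of "rev \<alpha>" n "[a]"] a by (simp add: c)
  ultimately show ?case
    using Cons.IH[OF a(2)]
    by (simp add: inversions_Cons[OF a] q_exponent_add_left q_exponent_add_right del: inversions.simps)
qed

lemma inversions_sorted: "sorted \<alpha> \<Longrightarrow> inversions \<alpha> = 0"
  by (induction \<alpha>) (auto simp: filter_empty_conv)

section \<open>Canonical words and the weight\<close>

text \<open>Among all rearrangements of the word, this choice minimises the absolute value of
  \<open>q ^ inversions\<close>, which is the cost of lifting a monomial.\<close>

definition canonical :: "complex \<Rightarrow> nat list \<Rightarrow> nat list" where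
  "canonical q \<alpha> = (if 1 \<le> norm q then sort \<alpha> else rev (sort \<alpha>))"

lemma mset_canonical [simp]: "mset (canonical q \<alpha>) = mset \<alpha>"
  by (simp add: canonical_def)

lemma words_canonical [simp]: "canonical q \<alpha> \<in> words n \<longleftrightarrow> \<alpha> \<in> words n"
  by (simp add: canonical_def)

lemma canonical_cong: "mset \<alpha> = mset \<beta> \<Longrightarrow> canonical q \<alpha> = canonical q \<beta>"
  by (metis canonical_def mset_sort properties_for_sort sorted_sort)

lemma letter_count_canonical [simp]: "letter_count (canonical q \<alpha>) = letter_count \<alpha>"
  by (simp add: letter_count_eq_iff)

lemma canonical_idem [simp]: "canonical q (canonical q \<alpha>) = canonical q \<alpha>"
  by (rule canonical_cong) simp

definition canonical_words :: "complex \<Rightarrow> nat \<Rightarrow> nat list set" where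
  "canonical_words q n = {\<alpha> \<in> words n. canonical q \<alpha> = \<alpha>}"

text \<open>Every class of rearrangements contains exactly one canonical word, so sums over
  multi-indices can be reindexed as sums over canonical words.\<close>

lemma bij_betw_letter_count_canonical: "bij_betw letter_count (canonical_words q n) (multi_indices n)"
  unfolding bij_betw_def
proof
  show "inj_on letter_count (canonical_words q n)"
    by (auto simp: inj_on_def canonical_words_def letter_count_eq_iff) (metis canonical_cong)
  have "k \<in> letter_count ` canonical_words q n" if k: "k \<in> multi_indices n" for k
  proof -
    obtain \<alpha> where "\<alpha> \<in> words n" "letter_count \<alpha> = k"
      using ex_sorted_word[OF k] by metis
    then show ?thesis
      by (intro image_eqI[of _ _ "canonical q \<alpha>"]) (auto simp: canonical_words_def)
  qed
  then show "letter_count ` canonical_words q n = multi_indices n"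
    by (auto simp: canonical_words_def letter_count_multi_indices)
qed

lemma inversions_le: "\<alpha> \<in> words n \<Longrightarrow> inversions \<alpha> \<le> q_exponent n (letter_count \<alpha>) (letter_count \<alpha>)"
  using inversions_rev[of \<alpha> n] by simp

text \<open>Termwise contractivity of the projection. For \<open>norm q\<close> at least 1 both
  factors are at most 1; otherwise the weight is bounded by
  \<open>norm q ^ inversions \<alpha>\<close>, because no word has more inversions than the
  decreasing one.\<close>

lemma q_weight_le:
  assumes "q \<noteq> 0" "\<alpha> \<in> words n"
  shows "norm (inverse q ^ inversions \<alpha>) * q_weight q n (letter_count \<alpha>) \<le> 1"
proof (cases "1 \<le> norm q")
  case True
  then show ?thesis
    unfolding q_weight_q_exponent
    by (intro mult_le_one) (auto simp: norm_power norm_inverse power_le_one inverse_le_1_iff)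
next
  case False
  have "norm (inverse q ^ inversions \<alpha>) * q_weight q n (letter_count \<alpha>) \<le>
      norm (inverse q ^ inversions \<alpha>) * norm q ^ inversions \<alpha>"
    unfolding q_weight_q_exponent
    using False inversions_le[OF assms(2)]
    by (intro mult_left_mono min.coboundedI1 power_decreasing) auto
  also have "\<dots> = 1"
    using assms(1) by (simp add: norm_power norm_inverse flip: power_mult_distrib)
  finally show ?thesis .
qed

text \<open>Termwise isometry of the section: canonical words realise the minimum in the definition
  of the weight.\<close>

lemma q_weight_canonical:
  assumes "\<alpha> \<in> canonical_words q n"
  shows "norm (q ^ inversions \<alpha>) = q_weight q n (letter_count \<alpha>)"
proof (cases "1 \<le> norm q")
  case True
  then have "sorted \<alpha>"
    using assms sorted_sort[of \<alpha>] by (auto simp: canonical_words_def canonical_def)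
  then show ?thesis
    using True by (simp add: inversions_sorted q_weight_q_exponent one_le_power min_absorb2)
next
  case False
  \<comment> \<open>Reversing the fixed-point equation identifies \<open>rev \<alpha>\<close> with
    \<open>sort \<alpha>\<close>, which has no inversions, so \<open>inversions_rev\<close> assigns
    all of them to \<open>\<alpha>\<close>.\<close>
  then have "rev (rev (sort \<alpha>)) = rev \<alpha>" and "\<alpha> \<in> words n"
    using assms by (simp_all add: canonical_words_def canonical_def)
  then have "sorted (rev \<alpha>)"
    using sorted_sort[of \<alpha>] by (simp only: rev_rev_ident)
  then have "inversions \<alpha> = q_exponent n (letter_count \<alpha>) (letter_count \<alpha>)"
    using \<open>\<alpha> \<in> words n\<close> inversions_rev[of \<alpha> n] by (simp add: inversions_sorted)
  then show ?thesis
    using False by (simp add: q_weight_q_exponent norm_power power_le_one min_absorb1)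
qed

section \<open>The projection onto ordered monomials and its section\<close>

text \<open>The fibres are finite, so this is defined on arbitrary formal series: linearity and
  multiplicativity are formal identities, and convergence enters only through the norm
  estimates.\<close>

definition ordering_map :: "complex \<Rightarrow> nat \<Rightarrow> (nat list \<Rightarrow> complex) \<Rightarrow> (nat \<Rightarrow> nat) \<Rightarrow> complex" where
  "ordering_map q n f k = (\<Sum>\<alpha> | \<alpha> \<in> words n \<and> letter_count \<alpha> = k. inverse q ^ inversions \<alpha> * f \<alpha>)"

text \<open>The factor \<open>q ^ inversions \<alpha>\<close> cancels the
  \<open>inverse q ^ inversions \<alpha>\<close> of \<open>ordering_map\<close>, which makes this a
  right inverse.\<close>

definition canonical_lift :: "complex \<Rightarrow> nat \<Rightarrow> ((nat \<Rightarrow> nat) \<Rightarrow> complex) \<Rightarrow> nat list \<Rightarrow> complex" where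
  "canonical_lift q n f \<alpha> = (if \<alpha> \<in> canonical_words q n then q ^ inversions \<alpha> * f (letter_count \<alpha>) else 0)"

lemma ordering_map_add: "ordering_map q n (\<lambda>\<alpha>. f \<alpha> + g \<alpha>) = (\<lambda>k. ordering_map q n f k + ordering_map q n g k)"
  by (simp add: ordering_map_def fun_eq_iff distrib_left sum.distrib)

lemma ordering_map_diff: "ordering_map q n (\<lambda>\<alpha>. f \<alpha> - g \<alpha>) = (\<lambda>k. ordering_map q n f k - ordering_map q n g k)"
  by (simp add: ordering_map_def fun_eq_iff right_diff_distrib sum_subtractf)

lemma ordering_map_scale: "ordering_map q n (\<lambda>\<alpha>. c * f \<alpha>) = (\<lambda>k. c * ordering_map q n f k)"
  by (simp add: ordering_map_def fun_eq_iff sum_distrib_left mult_ac)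

lemma ordering_map_outside:
  assumes "k \<notin> multi_indices n"
  shows "ordering_map q n f k = 0"
proof -
  have "{\<alpha> \<in> words n. letter_count \<alpha> = k} = {}"
    using assms letter_count_multi_indices by auto
  then show ?thesis unfolding ordering_map_def by (simp only: sum.empty)
qed

lemma ordering_map_single:
  assumes "\<alpha> \<in> words n"
  shows "ordering_map q n (\<lambda>\<beta>. if \<beta> = \<alpha> then 1 else 0) =
    (\<lambda>k. if k = letter_count \<alpha> then inverse q ^ inversions \<alpha> else 0)"
proof
  fix k
  have "ordering_map q n (\<lambda>\<beta>. if \<beta> = \<alpha> then 1 else 0) k =
      (\<Sum>\<beta> | \<beta> \<in> words n \<and> letter_count \<beta> = k. if \<beta> = \<alpha> then inverse q ^ inversions \<alpha> else 0)"
    unfolding ordering_map_def by (intro sum.cong) auto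
  then show "ordering_map q n (\<lambda>\<beta>. if \<beta> = \<alpha> then 1 else 0) k =
      (if k = letter_count \<alpha> then inverse q ^ inversions \<alpha> else 0)"
    using assms by (auto simp: finite_letter_count_fibre)
qed

text \<open>Both sides run over the pairs of words whose letter counts add up to \<open>m\<close>;
  the scalars agree by \<open>inversions_append\<close>.\<close>

lemma ordering_map_mult: "ordering_map q n (free.conv n f g) =
    quantum.conv n q (ordering_map q n f) (ordering_map q n g)"
proof
  fix m
  let ?F = "\<lambda>k. {\<alpha> \<in> words n. letter_count \<alpha> = k}"
  let ?u = "\<lambda>\<alpha>. inverse q ^ inversions \<alpha>"
  have "ordering_map q n (free.conv n f g) m =
      (\<Sum>\<alpha>\<in>?F m. \<Sum>x\<in>free.fibre n \<alpha>. ?u \<alpha> * (f (fst x) * g (snd x)))"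
    by (simp add: ordering_map_def free.conv_def case_prod_beta sum_distrib_left)
  also have "\<dots> = (\<Sum>z\<in>(SIGMA \<alpha>:?F m. free.fibre n \<alpha>). ?u (fst z) * (f (fst (snd z)) * g (snd (snd z))))"
    by (simp add: sum.Sigma finite_letter_count_fibre free.finite_fibre case_prod_beta)
  also have "\<dots> = (\<Sum>z\<in>(SIGMA x:quantum.fibre n m. ?F (fst x) \<times> ?F (snd x)).
      inverse q ^ q_exponent n (fst (fst z)) (snd (fst z)) *
        (?u (fst (snd z)) * f (fst (snd z))) * (?u (snd (snd z)) * g (snd (snd z))))"
    \<comment> \<open>Splitting a word and then counting letters is exchanged with first splitting
      the multi-index and then choosing a word for each part.\<close>
    by (rule sum.reindex_bij_witness[where
          i = "\<lambda>(x, (\<beta>, \<gamma>)). (\<beta> @ \<gamma>, (\<beta>, \<gamma>))" and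
          j = "\<lambda>(\<alpha>, (\<beta>, \<gamma>)). ((letter_count \<beta>, letter_count \<gamma>), (\<beta>, \<gamma>))"])
      (auto simp: free.fibre_def quantum.fibre_def letter_count_append letter_count_multi_indices
        inversions_append[of _ n] power_add)
  also have "\<dots> = (\<Sum>x\<in>quantum.fibre n m. \<Sum>y\<in>?F (fst x) \<times> ?F (snd x).
      inverse q ^ q_exponent n (fst x) (snd x) *
        (?u (fst y) * f (fst y)) * (?u (snd y) * g (snd y)))"
    by (simp add: sum.Sigma finite_letter_count_fibre quantum.finite_fibre case_prod_beta)
  also have "\<dots> = quantum.conv n q (ordering_map q n f) (ordering_map q n g) m"
    unfolding quantum.conv_def
  proof (intro sum.cong refl, clarify)
    fix k l
    have "ordering_map q n f k * ordering_map q n g l =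
        (\<Sum>y\<in>?F k \<times> ?F l. (?u (fst y) * f (fst y)) * (?u (snd y) * g (snd y)))"
      by (simp add: ordering_map_def sum_product sum.cartesian_product case_prod_beta)
    then show "(\<Sum>y\<in>?F (fst (k, l)) \<times> ?F (snd (k, l)). inverse q ^ q_exponent n (fst (k, l)) (snd (k, l)) *
        (?u (fst y) * f (fst y)) * (?u (snd y) * g (snd y))) =
      inverse q ^ q_exponent n k l * ordering_map q n f k * ordering_map q n g l"
      by (simp add: sum_distrib_left mult.assoc)
  qed
  finally show "ordering_map q n (free.conv n f g) m =
      quantum.conv n q (ordering_map q n f) (ordering_map q n g) m" .
qed

text \<open>The triangle inequality inside each fibre, combined with \<open>q_weight_le\<close>, and
  then a sum over the fibres.\<close>

lemma ordering_map_norm: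
  assumes "q \<noteq> 0" "0 < \<rho>" and f: "(\<lambda>\<alpha>. norm (f \<alpha>) * \<rho> ^ length \<alpha>) summable_on words n"
  shows "(\<lambda>k. norm (ordering_map q n f k) * q_weight q n k * \<rho> ^ mi_size n k) summable_on multi_indices n"
    and "quantum_norm q n \<rho> (ordering_map q n f) \<le> free_norm n \<rho> f"
proof -
  let ?F = "\<lambda>k. {\<alpha> \<in> words n. letter_count \<alpha> = k}"
  define u where "u = (\<lambda>\<alpha>. norm (f \<alpha>) * \<rho> ^ length \<alpha>)"
  \<comment> \<open>The words are partitioned by letter count, which turns a sum over words into a
    sum over multi-indices of finite sums.\<close>
  have bij: "bij_betw snd (SIGMA k:multi_indices n. ?F k) (words n)"
    by (rule bij_betw_byWitness[where f' = "\<lambda>\<alpha>. (letter_count \<alpha>, \<alpha>)"])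
      (auto simp: letter_count_multi_indices)
  have u_sum: "(\<lambda>z. u (snd z)) summable_on (SIGMA k:multi_indices n. ?F k)"
    using f summable_on_reindex_bij_betw[OF bij, of u] by (simp add: u_def)
  have fib: "(\<lambda>k. sum u (?F k)) summable_on multi_indices n"
    using summable_on_SigmaD[OF u_sum] finite_letter_count_fibre by simp
  have fib_inf: "(\<Sum>\<^sub>\<infinity>k\<in>multi_indices n. sum u (?F k)) = infsum u (words n)"
    using infsum_Sigma_banach[OF u_sum] finite_letter_count_fibre
    by (simp add: infsum_reindex_bij_betw[OF bij])
  have le: "norm (ordering_map q n f k) * q_weight q n k * \<rho> ^ mi_size n k \<le> sum u (?F k)" for k
  proof -
    have "norm (ordering_map q n f k) * (q_weight q n k * \<rho> ^ mi_size n k) \<le>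
        (\<Sum>\<alpha>\<in>?F k. norm (inverse q ^ inversions \<alpha> * f \<alpha>)) * (q_weight q n k * \<rho> ^ mi_size n k)"
      unfolding ordering_map_def
      by (intro mult_right_mono sum_norm_le) (use assms in \<open>auto simp: q_weight_nonneg\<close>)
    also have "\<dots> = (\<Sum>\<alpha>\<in>?F k. norm (inverse q ^ inversions \<alpha>) * q_weight q n k * (norm (f \<alpha>) * \<rho> ^ mi_size n k))"
      by (simp add: sum_distrib_left sum_distrib_right norm_mult mult_ac)
    also have "\<dots> \<le> sum u (?F k)"
    proof (rule sum_mono, clarify)
      fix \<alpha> assume \<alpha>: "\<alpha> \<in> words n"
      show "norm (inverse q ^ inversions \<alpha>) * q_weight q n (letter_count \<alpha>) *
          (norm (f \<alpha>) * \<rho> ^ mi_size n (letter_count \<alpha>)) \<le> u \<alpha>"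
        unfolding mi_size_letter_count[OF \<alpha>] u_def
        by (rule mult_left_le_one_le)
          (use q_weight_le[OF assms(1) \<alpha>] assms(2) in \<open>auto simp: q_weight_nonneg\<close>)
    qed
    finally show ?thesis by (simp add: mult.assoc)
  qed
  show *: "(\<lambda>k. norm (ordering_map q n f k) * q_weight q n k * \<rho> ^ mi_size n k) summable_on multi_indices n"
    by (rule summable_on_comparison_test[OF fib]) (use assms in \<open>auto simp: le q_weight_nonneg\<close>)
  show "quantum_norm q n \<rho> (ordering_map q n f) \<le> free_norm n \<rho> f"
    using infsum_mono[OF * fib le] unfolding fib_inf by (simp add: quantum_norm_def free_norm_def u_def)
qed

section \<open>The isometric linear section\<close>

lemma canonical_lift_diff: "canonical_lift q n (\<lambda>k. f k - g k) =
    (\<lambda>\<alpha>. canonical_lift q n f \<alpha> - canonical_lift q n g \<alpha>)"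
  by (simp add: canonical_lift_def fun_eq_iff right_diff_distrib)

lemma canonical_lift_add: "canonical_lift q n (\<lambda>k. f k + g k) =
    (\<lambda>\<alpha>. canonical_lift q n f \<alpha> + canonical_lift q n g \<alpha>)"
  by (simp add: canonical_lift_def fun_eq_iff distrib_left)

lemma canonical_lift_scale: "canonical_lift q n (\<lambda>k. c * f k) = (\<lambda>\<alpha>. c * canonical_lift q n f \<alpha>)"
  by (simp add: canonical_lift_def fun_eq_iff)

lemma canonical_lift_outside: "\<alpha> \<notin> words n \<Longrightarrow> canonical_lift q n f \<alpha> = 0"
  by (simp add: canonical_lift_def canonical_words_def)

lemma norm_lift_canonical:
  assumes "\<alpha> \<in> canonical_words q n"
  shows "norm (canonical_lift q n f \<alpha>) * \<rho> ^ length \<alpha> =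
    norm (f (letter_count \<alpha>)) * q_weight q n (letter_count \<alpha>) * \<rho> ^ mi_size n (letter_count \<alpha>)"
  using assms q_weight_canonical[OF assms] mi_size_letter_count[of \<alpha> n]
  by (simp add: canonical_lift_def norm_mult canonical_words_def)

lemma canonical_lift_summable:
  assumes "(\<lambda>k. norm (f k) * q_weight q n k * \<rho> ^ mi_size n k) summable_on multi_indices n"
  shows "(\<lambda>\<alpha>. norm (canonical_lift q n f \<alpha>) * \<rho> ^ length \<alpha>) summable_on words n"
proof -
  have "(\<lambda>\<alpha>. norm (f (letter_count \<alpha>)) * q_weight q n (letter_count \<alpha>) * \<rho> ^ mi_size n (letter_count \<alpha>))
      summable_on canonical_words q n"
    using assms summable_on_reindex_bij_betw[OF bij_betw_letter_count_canonical,
        of "\<lambda>k. norm (f k) * q_weight q n k * \<rho> ^ mi_size n k"] by blast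
  then have "(\<lambda>\<alpha>. norm (canonical_lift q n f \<alpha>) * \<rho> ^ length \<alpha>) summable_on canonical_words q n"
    by (simp add: norm_lift_canonical cong: summable_on_cong)
  then show ?thesis
    by (rule summable_on_cong_neutral[THEN iffD1, rotated -1])
      (auto simp: canonical_lift_def canonical_words_def)
qed

text \<open>The two sums agree termwise under the bijection with canonical words, so the equality
  also covers divergent sums, where \<open>infsum\<close> takes the default value 0 on both
  sides.\<close>

lemma canonical_lift_norm: "free_norm n \<rho> (canonical_lift q n f) = quantum_norm q n \<rho> f"
proof -
  have "free_norm n \<rho> (canonical_lift q n f) =
      (\<Sum>\<^sub>\<infinity>\<alpha>\<in>canonical_words q n. norm (canonical_lift q n f \<alpha>) * \<rho> ^ length \<alpha>)"
    unfolding free_norm_def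
    by (rule infsum_cong_neutral) (auto simp: canonical_lift_def canonical_words_def)
  also have "\<dots> = (\<Sum>\<^sub>\<infinity>\<alpha>\<in>canonical_words q n.
      norm (f (letter_count \<alpha>)) * q_weight q n (letter_count \<alpha>) * \<rho> ^ mi_size n (letter_count \<alpha>))"
    by (rule infsum_cong) (rule norm_lift_canonical)
  also have "\<dots> = quantum_norm q n \<rho> f"
    unfolding quantum_norm_def by (rule infsum_reindex_bij_betw[OF bij_betw_letter_count_canonical])
  finally show ?thesis .
qed

text \<open>In each fibre only the unique canonical word contributes, and its two powers of
  \<open>q\<close> cancel.\<close>

lemma ordering_map_lift:
  assumes "q \<noteq> 0" and f: "\<And>k. k \<notin> multi_indices n \<Longrightarrow> f k = 0"
  shows "ordering_map q n (canonical_lift q n f) = f"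
proof
  fix k
  show "ordering_map q n (canonical_lift q n f) k = f k"
  proof (cases "k \<in> multi_indices n")
    case True
    then obtain \<alpha> where \<alpha>: "\<alpha> \<in> canonical_words q n" "letter_count \<alpha> = k"
      using bij_betw_imp_surj_on[OF bij_betw_letter_count_canonical[of q n]] by (metis imageE)
    have uniq: "\<beta> = \<alpha>" if "\<beta> \<in> canonical_words q n" "letter_count \<beta> = k" for \<beta>
      using that \<alpha> bij_betw_letter_count_canonical[of q n] by (auto simp: bij_betw_def inj_on_def)
    have "ordering_map q n (canonical_lift q n f) k =
        (\<Sum>\<beta> | \<beta> \<in> words n \<and> letter_count \<beta> = k. if \<beta> = \<alpha> then f k else 0)"
      unfolding ordering_map_def
    proof (intro sum.cong refl)
      fix \<beta> assume "\<beta> \<in> {\<beta> \<in> words n. letter_count \<beta> = k}"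
      then have "\<beta> \<in> canonical_words q n \<longleftrightarrow> \<beta> = \<alpha>"
        using uniq[of \<beta>] \<alpha> by blast
      then show "inverse q ^ inversions \<beta> * canonical_lift q n f \<beta> = (if \<beta> = \<alpha> then f k else 0)"
        using \<alpha>(2) assms(1) by (simp add: canonical_lift_def power_inverse)
    qed
    also have "\<dots> = f k"
      using \<alpha> by (simp add: finite_letter_count_fibre canonical_words_def)
    finally show ?thesis .
  qed (simp add: ordering_map_outside f)
qed

text \<open>Lifting after projecting replaces a monomial by a multiple of its canonical
  rearrangement, with the same scalar that the commutation relations produce.\<close>

lemma canonical_lift_ordering_map_single:
  assumes "q \<noteq> 0" "\<alpha> \<in> words n"
  shows "canonical_lift q n (ordering_map q n (\<lambda>\<beta>. if \<beta> = \<alpha> then 1 else 0)) =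
    (\<lambda>\<beta>. if \<beta> = canonical q \<alpha> then inverse q ^ inversions \<alpha> * q ^ inversions (canonical q \<alpha>) else 0)"
proof
  fix \<beta>
  have "\<beta> \<in> canonical_words q n \<and> letter_count \<beta> = letter_count \<alpha> \<longleftrightarrow> \<beta> = canonical q \<alpha>"
    using assms(2) by (auto simp: canonical_words_def letter_count_eq_iff) (metis canonical_cong)
  then show "canonical_lift q n (ordering_map q n (\<lambda>\<beta>. if \<beta> = \<alpha> then 1 else 0)) \<beta> =
    (if \<beta> = canonical q \<alpha> then inverse q ^ inversions \<alpha> * q ^ inversions (canonical q \<alpha>) else 0)"
    by (auto simp: canonical_lift_def ordering_map_single[OF assms(2)])
qed

section \<open>The quantum polydisk as a quotient of the free polydisk\<close>

lemma radii_nonempty: "0 < r \<Longrightarrow> radii r \<noteq> {}"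
  using ereal_dense2[of 0 r] by (auto simp: radii_def)

lemma carrier_taylor_polydisk:
  "carrier (taylor_polydisk n r) = {f. (\<forall>\<alpha>. \<alpha> \<notin> words n \<longrightarrow> f \<alpha> = 0) \<and>
     (\<forall>\<rho>\<in>radii r. (\<lambda>\<alpha>. norm (f \<alpha>) * \<rho> ^ length \<alpha>) summable_on words n)}"
  by (auto simp: taylor_polydisk_def free_series_def)

text \<open>Brackets the weight into a single factor, the form expected by
  \<open>norm_family_weighted\<close>.\<close>

lemma carrier_quantum_polydisk:
  "carrier (quantum_polydisk q n r) = {f. (\<forall>k. k \<notin> multi_indices n \<longrightarrow> f k = 0) \<and>
     (\<forall>\<rho>\<in>radii r. (\<lambda>k. norm (f k) * (q_weight q n k * \<rho> ^ mi_size n k)) summable_on multi_indices n)}"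
  by (simp add: quantum_polydisk_def mult.assoc)

lemma taylor_polydisk_simps:
  "f \<oplus>\<^bsub>taylor_polydisk n r\<^esub> g = (\<lambda>\<alpha>. f \<alpha> + g \<alpha>)"
  "c \<odot>\<^bsub>taylor_polydisk n r\<^esub> f = (\<lambda>\<alpha>. c * f \<alpha>)"
  "\<zero>\<^bsub>taylor_polydisk n r\<^esub> = (\<lambda>_. 0)"
  "\<one>\<^bsub>taylor_polydisk n r\<^esub> = (\<lambda>\<alpha>. if \<alpha> = [] then 1 else 0)"
  by (simp_all add: taylor_polydisk_def free_series_def)

lemma norm_family_taylor:
  assumes "0 < r"
  shows "norm_family (carrier (taylor_polydisk n r)) (free_norm n) (radii r)"
proof -
  have "norm_family (carrier (taylor_polydisk n r))
      (\<lambda>\<rho> f. \<Sum>\<^sub>\<infinity>\<alpha>\<in>words n. norm (f \<alpha>) * \<rho> ^ length \<alpha>) (radii r)"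
    unfolding carrier_taylor_polydisk
    by (rule norm_family_weighted[OF radii_nonempty[OF assms]]) (simp add: radii_def)
  then show ?thesis by (simp add: free_norm_def[abs_def])
qed

lemma norm_family_quantum:
  assumes "q \<noteq> 0" "0 < r"
  shows "norm_family (carrier (quantum_polydisk q n r)) (quantum_norm q n) (radii r)"
proof -
  have "norm_family (carrier (quantum_polydisk q n r))
      (\<lambda>\<rho> f. \<Sum>\<^sub>\<infinity>k\<in>multi_indices n. norm (f k) * (q_weight q n k * \<rho> ^ mi_size n k)) (radii r)"
    unfolding carrier_quantum_polydisk
    by (rule norm_family_weighted[OF radii_nonempty[OF assms(2)]])
      (use assms(1) in \<open>simp add: radii_def q_weight_def\<close>)
  then show ?thesis by (simp add: quantum_norm_def[abs_def] mult.assoc)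
qed

lemma taylor_polydisk_uminus:
  assumes "f \<in> carrier (taylor_polydisk n r)"
  shows "\<ominus>\<^bsub>taylor_polydisk n r\<^esub> f = (\<lambda>\<alpha>. - f \<alpha>)"
proof (rule abelian_group.minus_equality[OF ring.is_abelian_group[OF ring_taylor_polydisk]])
  show "(\<lambda>\<alpha>. - f \<alpha>) \<in> carrier (taylor_polydisk n r)"
    using assms by (simp add: carrier_taylor_polydisk)
qed (use assms in \<open>simp_all add: taylor_polydisk_simps\<close>)

lemma taylor_polydisk_minus:
  assumes "g \<in> carrier (taylor_polydisk n r)"
  shows "f \<ominus>\<^bsub>taylor_polydisk n r\<^esub> g = (\<lambda>\<alpha>. f \<alpha> - g \<alpha>)"
  by (simp add: a_minus_def taylor_polydisk_uminus[OF assms] taylor_polydisk_simps)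

section \<open>Monomials of the free algebra\<close>

definition word_series :: "nat list \<Rightarrow> nat list \<Rightarrow> complex" where
  "word_series \<alpha> = (\<lambda>\<beta>. if \<beta> = \<alpha> then 1 else 0)"

lemma word_series_closed:
  assumes "\<alpha> \<in> words n"
  shows "word_series \<alpha> \<in> carrier (taylor_polydisk n r)"
proof -
  have "(\<lambda>\<beta>. norm (word_series \<alpha> \<beta>) * \<rho> ^ length \<beta>) summable_on words n" for \<rho> :: real
  proof -
    have "(\<lambda>\<beta>. norm (word_series \<alpha> \<beta>) * \<rho> ^ length \<beta>) summable_on {\<alpha>}" by simp
    then show ?thesis
      by (rule summable_on_cong_neutral[THEN iffD1, rotated -1])
        (use assms in \<open>auto simp: word_series_def\<close>)
  qed
  then show ?thesis
    using assms by (auto simp: carrier_taylor_polydisk word_series_def)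
qed

lemma free_gen_eq: "free_gen i = word_series [i]"
  by (simp add: free_gen_def word_series_def)

lemma word_series_mult:
  assumes "\<alpha> \<in> words n" "\<beta> \<in> words n"
  shows "word_series \<alpha> \<otimes>\<^bsub>taylor_polydisk n r\<^esub> word_series \<beta> = word_series (\<alpha> @ \<beta>)"
  using free.conv_single[OF assms] free_mult_eq_conv[OF assms[THEN word_series_closed], of r]
  by (simp add: word_series_def fun_eq_iff)

section \<open>Ideals containing the commutation relations\<close>

text \<open>An ideal of the free polydisk algebra containing the defining relations of the quantum polydisk.
  Modulo such an ideal, \<open>q ^ inversions \<alpha> \<cdot> \<zeta>\<^sub>\<alpha>\<close> depends only on the letters of \<open>\<alpha>\<close>.\<close>

locale relation_ideal = ideal I "taylor_polydisk n r" for I n r +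
  fixes q :: complex
  assumes relation: "1 \<le> i \<Longrightarrow> i < j \<Longrightarrow> j \<le> n \<Longrightarrow>
      (\<lambda>\<alpha>. word_series [i, j] \<alpha> - q * word_series [j, i] \<alpha>) \<in> I"
begin

text \<open>A ring ideal absorbs scalars because \<open>c\<close> times \<open>f\<close> is the
  product of \<open>c\<close> times the unit with \<open>f\<close>.\<close>

lemma scale_closed:
  assumes "f \<in> I"
  shows "(\<lambda>\<alpha>. c * f \<alpha>) \<in> I"
proof -
  interpret module complex_ring "taylor_polydisk n r" by (rule module_taylor_polydisk)
  have c: "c \<in> carrier complex_ring" by (simp add: ring_of_type_algebra_def)
  have f: "f \<in> carrier (taylor_polydisk n r)" using assms a_subset by blast
  have "(c \<odot>\<^bsub>taylor_polydisk n r\<^esub> \<one>\<^bsub>taylor_polydisk n r\<^esub>) \<otimes>\<^bsub>taylor_polydisk n r\<^esub> f \<in> I"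
    using assms c by (intro I_l_closed smult_closed) auto
  then show ?thesis
    using f by (simp add: taylor_polydisk_smult_mult) (simp add: taylor_polydisk_simps)
qed

lemma add_closed: "f \<in> I \<Longrightarrow> g \<in> I \<Longrightarrow> (\<lambda>\<alpha>. f \<alpha> + g \<alpha>) \<in> I"
  using additive_subgroup.a_closed[OF additive_subgroup_axioms, of f g] by (simp add: taylor_polydisk_simps)

lemma zero_mem: "(\<lambda>_. 0) \<in> I"
  using additive_subgroup.zero_closed[OF additive_subgroup_axioms] by (simp add: taylor_polydisk_simps)

lemma diff_closed: "f \<in> I \<Longrightarrow> g \<in> I \<Longrightarrow> (\<lambda>\<alpha>. f \<alpha> - g \<alpha>) \<in> I"
  using add_closed[OF _ scale_closed[of g "-1"], of f] by simp

lemma word_series_left: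
  assumes "\<alpha> \<in> words n" "\<beta> \<in> words n" "\<gamma> \<in> words n"
    and "(\<lambda>\<delta>. b * word_series \<beta> \<delta> - c * word_series \<gamma> \<delta>) \<in> I"
  shows "(\<lambda>\<delta>. b * word_series (\<alpha> @ \<beta>) \<delta> - c * word_series (\<alpha> @ \<gamma>) \<delta>) \<in> I"
proof -
  \<comment> \<open>Subtraction is rewritten as addition of a multiple by \<open>- c\<close>, so
    that the additivity and scaling rules of \<open>conv\<close> apply.\<close>
  let ?h = "\<lambda>\<delta>. b * word_series \<beta> \<delta> + (- c) * word_series \<gamma> \<delta>"
  have h: "?h \<in> I" using assms(4) by simp
  have "word_series \<alpha> \<otimes>\<^bsub>taylor_polydisk n r\<^esub> ?h = free.conv n (word_series \<alpha>) ?h"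
    using h a_subset by (intro free_mult_eq_conv word_series_closed assms) blast
  also have "\<dots> = (\<lambda>\<delta>. b * word_series (\<alpha> @ \<beta>) \<delta> + (- c) * word_series (\<alpha> @ \<gamma>) \<delta>)"
    unfolding free.conv_add_right free.conv_scale_right
    using assms free_mult_eq_conv[OF word_series_closed word_series_closed, of \<alpha> n _ r]
    by (simp add: word_series_mult)
  finally show ?thesis
    using I_l_closed[OF h word_series_closed[OF assms(1)]] by simp
qed

lemma word_series_right:
  assumes "\<alpha> \<in> words n" "\<beta> \<in> words n" "\<gamma> \<in> words n"
    and "(\<lambda>\<delta>. b * word_series \<beta> \<delta> - c * word_series \<gamma> \<delta>) \<in> I"
  shows "(\<lambda>\<delta>. b * word_series (\<beta> @ \<alpha>) \<delta> - c * word_series (\<gamma> @ \<alpha>) \<delta>) \<in> I"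
proof -
  let ?h = "\<lambda>\<delta>. b * word_series \<beta> \<delta> + (- c) * word_series \<gamma> \<delta>"
  have h: "?h \<in> I" using assms(4) by simp
  have "?h \<otimes>\<^bsub>taylor_polydisk n r\<^esub> word_series \<alpha> = free.conv n ?h (word_series \<alpha>)"
    using h a_subset by (intro free_mult_eq_conv word_series_closed assms) blast
  also have "\<dots> = (\<lambda>\<delta>. b * word_series (\<beta> @ \<alpha>) \<delta> + (- c) * word_series (\<gamma> @ \<alpha>) \<delta>)"
    unfolding free.conv_add_left free.conv_scale_left
    using assms free_mult_eq_conv[OF word_series_closed word_series_closed, of _ n \<alpha> r]
    by (simp add: word_series_mult)
  finally show ?thesis
    using I_r_closed[OF h word_series_closed[OF assms(1)]] by simp
qed

text \<open>With these powers of \<open>q\<close> built in, congruence is an equivalence relation on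
  bare words and no scalars have to be carried along.\<close>

definition congruent_words :: "nat list \<Rightarrow> nat list \<Rightarrow> bool" where
  "congruent_words \<alpha> \<beta> \<longleftrightarrow>
     (\<lambda>\<gamma>. q ^ inversions \<alpha> * word_series \<alpha> \<gamma> - q ^ inversions \<beta> * word_series \<beta> \<gamma>) \<in> I"

lemma congruent_words_refl: "congruent_words \<alpha> \<alpha>"
  using zero_mem by (simp add: congruent_words_def)

lemma congruent_words_sym: "congruent_words \<alpha> \<beta> \<Longrightarrow> congruent_words \<beta> \<alpha>"
  using scale_closed[of _ "-1"] by (fastforce simp: congruent_words_def)

lemma congruent_words_trans: "congruent_words \<alpha> \<beta> \<Longrightarrow> congruent_words \<beta> \<gamma> \<Longrightarrow> congruent_words \<alpha> \<gamma>"
  unfolding congruent_words_def by (drule (1) add_closed) simp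

text \<open>Rearrangements of each other gain equally many inversions from a common first letter, so
  both sides acquire the same power of \<open>q\<close>; this is the purpose of the
  \<open>mset\<close> hypothesis.\<close>

lemma congruent_words_Cons:
  assumes "a \<in> {1..n}" "\<alpha> \<in> words n" "\<beta> \<in> words n" "mset \<alpha> = mset \<beta>" "congruent_words \<alpha> \<beta>"
  shows "congruent_words (a # \<alpha>) (a # \<beta>)"
proof -
  have "length (filter (\<lambda>b. b < a) \<alpha>) = length (filter (\<lambda>b. b < a) \<beta>)"
    using assms(4) by (metis mset_filter size_mset)
  moreover have "(\<lambda>\<gamma>. q ^ inversions \<alpha> * word_series ([a] @ \<alpha>) \<gamma> - q ^ inversions \<beta> * word_series ([a] @ \<beta>) \<gamma>) \<in> I"
    by (rule word_series_left) (use assms in \<open>auto simp: congruent_words_def\<close>)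
  from scale_closed[OF this, of "q ^ length (filter (\<lambda>b. b < a) \<beta>)"]
  have "(\<lambda>\<gamma>. q ^ length (filter (\<lambda>b. b < a) \<beta>) *
      (q ^ inversions \<alpha> * word_series (a # \<alpha>) \<gamma> - q ^ inversions \<beta> * word_series (a # \<beta>) \<gamma>)) \<in> I"
    by simp
  ultimately show ?thesis
    by (simp add: congruent_words_def power_add right_diff_distrib mult.assoc)
qed

text \<open>Exchanging two adjacent increasing letters creates exactly one inversion, which absorbs
  the factor \<open>q\<close> of the relation.\<close>

lemma congruent_words_swap:
  assumes "a \<in> {1..n}" "b \<in> {1..n}" "\<alpha> \<in> words n" "b < a"
  shows "congruent_words (b # a # \<alpha>) (a # b # \<alpha>)"
proof -
  have "(\<lambda>\<gamma>. 1 * word_series ([b, a] @ \<alpha>) \<gamma> - q * word_series ([a, b] @ \<alpha>) \<gamma>) \<in> I"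
    by (rule word_series_right) (use assms relation[of b a] in auto)
  from scale_closed[OF this, of "q ^ inversions (b # a # \<alpha>)"]
  have "(\<lambda>\<gamma>. q ^ inversions (b # a # \<alpha>) * (word_series (b # a # \<alpha>) \<gamma> - q * word_series (a # b # \<alpha>) \<gamma>)) \<in> I"
    by simp
  moreover have "inversions (a # b # \<alpha>) = Suc (inversions (b # a # \<alpha>))"
    using assms(4) by simp
  ultimately show ?thesis
    by (simp add: congruent_words_def right_diff_distrib mult_ac del: inversions.simps)
qed

text \<open>The head letter moves to the right by adjacent swaps until it reaches its place.\<close>

lemma congruent_words_insort:
  assumes "a \<in> {1..n}" "\<alpha> \<in> words n"
  shows "congruent_words (a # \<alpha>) (insort a \<alpha>)"
  using assms(2)
proof (induction \<alpha>)
  case (Cons b \<alpha>)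
  then have b: "b \<in> {1..n}" "\<alpha> \<in> words n" by auto
  show ?case
  proof (cases "a \<le> b")
    case False
    have "congruent_words (a # b # \<alpha>) (b # a # \<alpha>)"
      using False assms(1) b by (intro congruent_words_sym[OF congruent_words_swap]) auto
    moreover have "congruent_words (b # a # \<alpha>) (b # insort a \<alpha>)"
      using assms(1) b by (intro congruent_words_Cons Cons.IH)
        (auto simp: words_def in_lists_conv_set set_insort_key)
    ultimately show ?thesis
      using False congruent_words_trans by simp
  qed (simp add: congruent_words_refl)
qed (simp add: congruent_words_refl)

lemma congruent_words_sort: "\<alpha> \<in> words n \<Longrightarrow> congruent_words \<alpha> (sort \<alpha>)"
proof (induction \<alpha>)
  case (Cons a \<alpha>)
  then have a: "a \<in> {1..n}" "\<alpha> \<in> words n" by auto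
  have "congruent_words (a # \<alpha>) (a # sort \<alpha>)"
    using a by (intro congruent_words_Cons Cons.IH) auto
  moreover have "congruent_words (a # sort \<alpha>) (insort a (sort \<alpha>))"
    using a by (intro congruent_words_insort) auto
  ultimately show ?case
    using congruent_words_trans by simp
qed (simp add: congruent_words_refl)

text \<open>A word and its canonical form have the same sorted form, so symmetry and transitivity
  cover the decreasing case as well.\<close>

lemma congruent_words_canonical:
  assumes "\<alpha> \<in> words n"
  shows "congruent_words \<alpha> (canonical q \<alpha>)"
proof -
  have "sort (canonical q \<alpha>) = sort \<alpha>"
    by (metis mset_canonical mset_sort properties_for_sort sorted_sort)
  then show ?thesis
    using congruent_words_sort[of \<alpha>] congruent_words_sort[of "canonical q \<alpha>"] assms
      congruent_words_trans congruent_words_sym by (metis words_canonical)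
qed

text \<open>The congruence with the canonical word, divided by
  \<open>q ^ inversions \<alpha>\<close>.\<close>

lemma word_series_diff_lift_ordering_map:
  assumes "q \<noteq> 0" "\<alpha> \<in> words n"
  shows "(\<lambda>\<beta>. word_series \<alpha> \<beta> - canonical_lift q n (ordering_map q n (word_series \<alpha>)) \<beta>) \<in> I"
proof -
  have "canonical_lift q n (ordering_map q n (word_series \<alpha>)) =
      (\<lambda>\<beta>. inverse q ^ inversions \<alpha> * (q ^ inversions (canonical q \<alpha>) * word_series (canonical q \<alpha>) \<beta>))"
    using canonical_lift_ordering_map_single[OF assms] by (auto simp: word_series_def)
  moreover have "word_series \<alpha> \<beta> = inverse q ^ inversions \<alpha> * (q ^ inversions \<alpha> * word_series \<alpha> \<beta>)" for \<beta>
    using assms(1) by (simp add: power_inverse)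
  ultimately have "(\<lambda>\<beta>. word_series \<alpha> \<beta> - canonical_lift q n (ordering_map q n (word_series \<alpha>)) \<beta>) =
      (\<lambda>\<beta>. inverse q ^ inversions \<alpha> * (q ^ inversions \<alpha> * word_series \<alpha> \<beta>
        - q ^ inversions (canonical q \<alpha>) * word_series (canonical q \<alpha>) \<beta>))"
    by (simp only: right_diff_distrib)
  then show ?thesis
    using scale_closed congruent_words_canonical[OF assms(2)] by (simp add: congruent_words_def)
qed

text \<open>Linear extension from monomials to finite truncations, one word at a time; the passage
  to infinite series is left to closedness of the ideal.\<close>

lemma finite_diff_lift_ordering_map:
  assumes "q \<noteq> 0" "finite A" "A \<subseteq> words n"
  shows "(\<lambda>\<beta>. (if \<beta> \<in> A then f \<beta> else 0)
      - canonical_lift q n (ordering_map q n (\<lambda>\<beta>. if \<beta> \<in> A then f \<beta> else 0)) \<beta>) \<in> I"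
  using assms(2,3)
proof (induction A)
  case empty
  have "ordering_map q n (\<lambda>_. 0) = (\<lambda>_. 0)" "canonical_lift q n (\<lambda>_. 0) = (\<lambda>_. 0)"
    by (auto simp: ordering_map_def canonical_lift_def)
  then show ?case
    using zero_mem by simp
next
  case (insert \<alpha> A)
  let ?t = "\<lambda>A \<beta>. if \<beta> \<in> A then f \<beta> else 0"
  have t: "?t (insert \<alpha> A) = (\<lambda>\<beta>. ?t A \<beta> + f \<alpha> * word_series \<alpha> \<beta>)"
    using insert.hyps(2) by (auto simp: word_series_def)
  have "(\<lambda>\<beta>. (?t A \<beta> - canonical_lift q n (ordering_map q n (?t A)) \<beta>) +
      f \<alpha> * (word_series \<alpha> \<beta> - canonical_lift q n (ordering_map q n (word_series \<alpha>)) \<beta>)) \<in> I"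
    using insert.prems
    by (intro add_closed scale_closed insert.IH word_series_diff_lift_ordering_map assms(1)) auto
  moreover have "canonical_lift q n (ordering_map q n (?t (insert \<alpha> A))) =
      (\<lambda>\<beta>. canonical_lift q n (ordering_map q n (?t A)) \<beta> + f \<alpha> * canonical_lift q n (ordering_map q n (word_series \<alpha>)) \<beta>)"
    by (simp only: t ordering_map_add ordering_map_scale canonical_lift_add canonical_lift_scale)
  moreover have "?t (insert \<alpha> A) \<beta> = ?t A \<beta> + f \<alpha> * word_series \<alpha> \<beta>" for \<beta>
    by (rule fun_cong[OF t])
  ultimately show ?case
    by (simp only: right_diff_distrib add_diff_add)
qed

end

section \<open>The homomorphism between the polydisk algebras\<close>

lemma ordering_map_closed:
  assumes "q \<noteq> 0" "f \<in> carrier (taylor_polydisk n r)"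
  shows "ordering_map q n f \<in> carrier (quantum_polydisk q n r)"
  using assms ordering_map_norm(1)[OF assms(1), of _ f n]
  by (auto simp: carrier_taylor_polydisk quantum_polydisk_def ordering_map_outside radii_def)

lemma canonical_lift_closed:
  assumes "f \<in> carrier (quantum_polydisk q n r)"
  shows "canonical_lift q n f \<in> carrier (taylor_polydisk n r)"
  using assms canonical_lift_summable
      by (auto simp: carrier_taylor_polydisk quantum_polydisk_def canonical_lift_outside)

lemma ordering_map_lift_carrier:
  assumes "q \<noteq> 0" "f \<in> carrier (quantum_polydisk q n r)"
  shows "ordering_map q n (canonical_lift q n f) = f"
  using assms by (intro ordering_map_lift) (auto simp: quantum_polydisk_def)

lemma ordering_map_norm_le:
  assumes "q \<noteq> 0" "f \<in> carrier (taylor_polydisk n r)" "\<rho> \<in> radii r"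
  shows "quantum_norm q n \<rho> (ordering_map q n f) \<le> free_norm n \<rho> f"
  using assms by (intro ordering_map_norm(2)) (auto simp: carrier_taylor_polydisk radii_def)

lemma ordering_map_hom:
  assumes "q \<noteq> 0"
  shows "ordering_map q n \<in> algebra_hom (taylor_polydisk n r) (quantum_polydisk q n r)"
proof -
  have "ordering_map q n \<in> ring_hom (taylor_polydisk n r) (quantum_polydisk q n r)"
  proof (rule ring_hom_memI)
    show "ordering_map q n f \<in> carrier (quantum_polydisk q n r)" if "f \<in> carrier (taylor_polydisk n r)" for f
      using ordering_map_closed[OF assms that] .
    show "ordering_map q n (f \<otimes>\<^bsub>taylor_polydisk n r\<^esub> g) =
        ordering_map q n f \<otimes>\<^bsub>quantum_polydisk q n r\<^esub> ordering_map q n g"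
      if "f \<in> carrier (taylor_polydisk n r)" "g \<in> carrier (taylor_polydisk n r)" for f g
      using free_mult_eq_conv[OF that]
      by (simp add: ordering_map_mult) (simp add: quantum_polydisk_def quantum_mult_eq_conv)
    show "ordering_map q n (f \<oplus>\<^bsub>taylor_polydisk n r\<^esub> g) =
        ordering_map q n f \<oplus>\<^bsub>quantum_polydisk q n r\<^esub> ordering_map q n g" for f g
      by (simp add: taylor_polydisk_simps ordering_map_add) (simp add: quantum_polydisk_def)
    show "ordering_map q n \<one>\<^bsub>taylor_polydisk n r\<^esub> = \<one>\<^bsub>quantum_polydisk q n r\<^esub>"
      by (simp add: taylor_polydisk_simps ordering_map_single letter_count_Nil)
        (simp add: quantum_polydisk_def monom_series_def fun_eq_iff)
  qed
  moreover have "ordering_map q n (c \<odot>\<^bsub>taylor_polydisk n r\<^esub> f) =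
      c \<odot>\<^bsub>quantum_polydisk q n r\<^esub> ordering_map q n f" for c f
    by (simp add: taylor_polydisk_simps ordering_map_scale) (simp add: quantum_polydisk_def)
  ultimately show ?thesis
    by (simp add: algebra_hom_def)
qed

lemma ordering_map_word_series:
  assumes "\<alpha> \<in> words n"
  shows "ordering_map q n (word_series \<alpha>) = (\<lambda>k. if k = letter_count \<alpha> then inverse q ^ inversions \<alpha> else 0)"
  using ordering_map_single[OF assms] by (simp add: word_series_def)

lemma ordering_map_free_gen:
  assumes "i \<in> {1..n}"
  shows "ordering_map q n (free_gen i) = quantum_gen i"
  using assms ordering_map_word_series[of "[i]" n q]
  by (simp add: free_gen_eq quantum_gen_def monom_series_def letter_count_single fun_eq_iff)

text \<open>Both words lie over the same monomial, and the single inversion of \<open>[j, i]\<close>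
  supplies the \<open>inverse q\<close> that cancels \<open>q\<close>.\<close>

lemma ordering_map_relation:
  assumes "q \<noteq> 0" "1 \<le> i" "i < j" "j \<le> n"
  shows "ordering_map q n (\<lambda>\<alpha>. word_series [i, j] \<alpha> - q * word_series [j, i] \<alpha>) = (\<lambda>_. 0)"
proof -
  have "letter_count [i, j] = letter_count [j, i]"
    by (simp add: letter_count_eq_iff)
  then show ?thesis
    using assms by (simp add: ordering_map_diff ordering_map_scale ordering_map_word_series fun_eq_iff)
qed

section \<open>A bounded projection and the complement of the kernel\<close>

context
  fixes q :: complex and n :: nat and r :: ereal
  assumes q: "q \<noteq> 0" and r: "0 < r"
begin

interpretation F: norm_family "carrier (taylor_polydisk n r)" "free_norm n" "radii r"
  using r by (rule norm_family_taylor)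

lemma continuous_map_ordering_map:
  "continuous_map (taylor_topology n r) (quantum_topology q n r) (ordering_map q n)"
  unfolding taylor_topology_def quantum_topology_def
  by (rule F.continuous_map_bounded[where C = 1])
    (use q r in \<open>auto simp: norm_family_quantum ordering_map_closed ordering_map_diff ordering_map_norm_le\<close>)

lemma a_kernel_ordering_map:
  "a_kernel (taylor_polydisk n r) (quantum_polydisk q n r) (ordering_map q n) =
    {f \<in> carrier (taylor_polydisk n r). ordering_map q n f = (\<lambda>_. 0)}"
  by (simp add: a_kernel_def' quantum_polydisk_def)

lemma canonical_lift_ordering_map_closed:
  "f \<in> carrier (taylor_polydisk n r) \<Longrightarrow> canonical_lift q n (ordering_map q n f) \<in> carrier (taylor_polydisk n r)"
  using q by (intro canonical_lift_closed ordering_map_closed)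

lemma canonical_lift_ordering_map_diff:
  "canonical_lift q n (ordering_map q n (\<lambda>\<alpha>. f \<alpha> - g \<alpha>)) =
      (\<lambda>\<alpha>. canonical_lift q n (ordering_map q n f) \<alpha> - canonical_lift q n (ordering_map q n g) \<alpha>)"
  by (simp add: ordering_map_diff canonical_lift_diff)

text \<open>The factor \<open>1 *\<close> matches the constant \<open>C\<close> in
  \<open>projection_complement\<close>.\<close>

lemma canonical_lift_ordering_map_norm_le:
  "\<rho> \<in> radii r \<Longrightarrow> f \<in> carrier (taylor_polydisk n r) \<Longrightarrow>
    free_norm n \<rho> (canonical_lift q n (ordering_map q n f)) \<le> 1 * free_norm n \<rho> f"
  using q by (simp add: canonical_lift_norm ordering_map_norm_le)

lemma ordering_map_lift_ordering_map:
  "f \<in> carrier (taylor_polydisk n r) \<Longrightarrow> ordering_map q n (canonical_lift q n (ordering_map q n f)) =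
      ordering_map q n f"
  using q by (intro ordering_map_lift_carrier ordering_map_closed)

text \<open>Applying \<open>ordering_map\<close> once more recovers
  \<open>ordering_map q n f\<close>, so the projection and the homomorphism have the same
  kernel.\<close>

lemma canonical_lift_ordering_map_eq_zero_iff:
  assumes "f \<in> carrier (taylor_polydisk n r)"
  shows "canonical_lift q n (ordering_map q n f) = (\<lambda>_. 0) \<longleftrightarrow> ordering_map q n f = (\<lambda>_. 0)"
proof
  assume "canonical_lift q n (ordering_map q n f) = (\<lambda>_. 0)"
  then show "ordering_map q n f = (\<lambda>_. 0)"
    using ordering_map_lift_ordering_map[OF assms] by (simp add: ordering_map_def fun_eq_iff)
qed (simp add: canonical_lift_def fun_eq_iff)

text \<open>Idempotence is \<open>ordering_map_lift_ordering_map\<close> with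
  \<open>canonical_lift\<close> applied to both sides, whence the \<open>arg_cong\<close>.\<close>

lemmas canonical_lift_ordering_map_complement =
    F.projection_complement[of "\<lambda>f. canonical_lift q n (ordering_map q n f)" 1,
    OF canonical_lift_ordering_map_closed canonical_lift_ordering_map_diff
        canonical_lift_ordering_map_norm_le arg_cong[OF ordering_map_lift_ordering_map],
    folded taylor_topology_def]

lemma a_kernel_ordering_map_eq:
  "a_kernel (taylor_polydisk n r) (quantum_polydisk q n r) (ordering_map q n) =
    {f \<in> carrier (taylor_polydisk n r). canonical_lift q n (ordering_map q n f) = (\<lambda>_. 0)}"
  using canonical_lift_ordering_map_eq_zero_iff by (auto simp: a_kernel_ordering_map)

lemma complemented_a_kernel_ordering_map:
  "complemented_subspace (taylor_polydisk n r) (taylor_topology n r)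
    (a_kernel (taylor_polydisk n r) (quantum_polydisk q n r) (ordering_map q n))"
  unfolding complemented_subspace_def
proof (intro conjI exI)
  interpret module complex_ring "taylor_polydisk n r" by (rule module_taylor_polydisk)
  \<comment> \<open>The complement consists of the fixed points of the projection, that is, of the
    lifts of elements of the quantum polydisk.\<close>
  let ?L = "{f \<in> carrier (taylor_polydisk n r). canonical_lift q n (ordering_map q n f) = f}"
  have linear: "canonical_lift q n (ordering_map q n (\<lambda>\<alpha>. f \<alpha> + g \<alpha>)) =
      (\<lambda>\<alpha>. canonical_lift q n (ordering_map q n f) \<alpha> + canonical_lift q n (ordering_map q n g) \<alpha>)"
    "canonical_lift q n (ordering_map q n (\<lambda>\<alpha>. c * f \<alpha>)) = (\<lambda>\<alpha>. c * canonical_lift q n (ordering_map q n f) \<alpha>)"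
    "canonical_lift q n (ordering_map q n (\<lambda>\<alpha>. - f \<alpha>)) = (\<lambda>\<alpha>. - canonical_lift q n (ordering_map q n f) \<alpha>)"
    "canonical_lift q n (ordering_map q n (\<lambda>\<alpha>. 0)) = (\<lambda>_. 0)" for f g c
    \<comment> \<open>Negation and zero are treated as scaling by -1 and by 0.\<close>
    using ordering_map_scale[of q n "-1" f] canonical_lift_scale[of q n "-1" "ordering_map q n f"]
      ordering_map_scale[of q n 0 f] canonical_lift_scale[of q n 0 "ordering_map q n f"]
    by (simp_all add: ordering_map_add canonical_lift_add ordering_map_scale canonical_lift_scale)
  have scale: "(\<lambda>\<alpha>. c * f \<alpha>) \<in> carrier (taylor_polydisk n r)" if "f \<in> carrier (taylor_polydisk n r)" for c f
    using smult_closed[of c f] that by (simp add: taylor_polydisk_simps ring_of_type_algebra_def)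
  show "submodule (a_kernel (taylor_polydisk n r) (quantum_polydisk q n r) (ordering_map q n))
      complex_ring (taylor_polydisk n r)"
    unfolding a_kernel_ordering_map_eq
    by (rule submoduleI) (auto simp: taylor_polydisk_uminus F.uminus_closed F.add_closed F.zero_closed scale
        linear taylor_polydisk_simps)
  show "submodule ?L complex_ring (taylor_polydisk n r)"
    by (rule submoduleI) (auto simp: taylor_polydisk_uminus F.uminus_closed F.add_closed F.zero_closed scale
        linear taylor_polydisk_simps)
  show "closedin (taylor_topology n r) (a_kernel (taylor_polydisk n r) (quantum_polydisk q n r) (ordering_map q n))"
    unfolding a_kernel_ordering_map_eq by (rule canonical_lift_ordering_map_complement(1))
  show "closedin (taylor_topology n r) ?L"
    by (rule canonical_lift_ordering_map_complement(2))
  show "homeomorphic_map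
      (prod_topology
        (subtopology (taylor_topology n r) (a_kernel (taylor_polydisk n r) (quantum_polydisk q n r) (ordering_map q n)))
        (subtopology (taylor_topology n r) ?L))
      (taylor_topology n r) (\<lambda>(f, g). f \<oplus>\<^bsub>taylor_polydisk n r\<^esub> g)"
    unfolding a_kernel_ordering_map_eq taylor_polydisk_simps by (rule canonical_lift_ordering_map_complement(3))
qed

section \<open>Generators of the kernel and the quotient norm\<close>

text \<open>The norm of the tail is the full sum minus a finite partial sum, so absolute convergence
  makes finite truncations dense.\<close>

lemma truncation_tendsto:
  assumes f: "f \<in> carrier (taylor_polydisk n r)" and \<rho>: "\<rho> \<in> radii r"
  shows "((\<lambda>A. free_norm n \<rho> (\<lambda>\<alpha>. (if \<alpha> \<in> A then f \<alpha> else 0) - f \<alpha>)) \<longlongrightarrow> 0)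
    (finite_subsets_at_top (words n))"
proof -
  let ?u = "\<lambda>\<alpha>. norm (f \<alpha>) * \<rho> ^ length \<alpha>"
  have u: "?u summable_on words n"
    using f \<rho> by (simp add: carrier_taylor_polydisk)
  have "free_norm n \<rho> (\<lambda>\<alpha>. (if \<alpha> \<in> A then f \<alpha> else 0) - f \<alpha>) = infsum ?u (words n) - sum ?u A"
    if A: "finite A" "A \<subseteq> words n" for A
  proof -
    have "free_norm n \<rho> (\<lambda>\<alpha>. (if \<alpha> \<in> A then f \<alpha> else 0) - f \<alpha>) = infsum ?u (words n - A)"
      unfolding free_norm_def by (rule infsum_cong_neutral) auto
    also have "\<dots> = infsum ?u (words n) - infsum ?u A"
      using A u by (intro infsum_Diff) auto
    finally show ?thesis using A by simp
  qed
  then have "\<forall>\<^sub>F A in finite_subsets_at_top (words n). infsum ?u (words n) - sum ?u A =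
      free_norm n \<rho> (\<lambda>\<alpha>. (if \<alpha> \<in> A then f \<alpha> else 0) - f \<alpha>)"
    by (intro eventually_finite_subsets_at_top_weakI) simp
  \<comment> \<open>The limit is first stated as a difference, which is the form that the limit
    rules produce.\<close>
  moreover have "((\<lambda>A. infsum ?u (words n) - sum ?u A) \<longlongrightarrow> infsum ?u (words n) - infsum ?u (words n))
      (finite_subsets_at_top (words n))"
    by (intro tendsto_intros infsum_tendsto u)
  then have "((\<lambda>A. infsum ?u (words n) - sum ?u A) \<longlongrightarrow> 0) (finite_subsets_at_top (words n))"
    by (simp only: diff_self)
  ultimately show ?thesis
    by (rule Lim_transform_eventually[rotated])
qed

text \<open>Truncations corrected by their projections lie in \<open>I\<close> and converge to
  \<open>f\<close> minus its projection, which is \<open>f\<close> itself on the kernel; closedness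
  of \<open>I\<close> concludes.\<close>

lemma ordering_map_kernel_subset:
  assumes "relation_ideal I n r q" and closed: "closedin (taylor_topology n r) I"
    and f: "f \<in> carrier (taylor_polydisk n r)" and f0: "ordering_map q n f = (\<lambda>_. 0)"
  shows "f \<in> I"
proof -
  interpret relation_ideal I n r q by fact
  let ?t = "\<lambda>A \<alpha>. if \<alpha> \<in> A then f \<alpha> else 0"
  let ?g = "\<lambda>A \<alpha>. ?t A \<alpha> - canonical_lift q n (ordering_map q n (?t A)) \<alpha>"
  have t: "?t A \<in> carrier (taylor_polydisk n r)" for A
  proof -
    have "(\<lambda>\<alpha>. norm (?t A \<alpha>) * \<rho> ^ length \<alpha>) summable_on words n" if "\<rho> \<in> radii r" for \<rho>
      by (rule summable_on_comparison_test[where f = "\<lambda>\<alpha>. norm (f \<alpha>) * \<rho> ^ length \<alpha>"])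
        (use f that in \<open>auto simp: carrier_taylor_polydisk radii_def\<close>)
    then show ?thesis using f by (auto simp: carrier_taylor_polydisk)
  qed
  have "limitin (taylor_topology n r) ?g f (finite_subsets_at_top (words n))"
    unfolding taylor_topology_def
  proof (rule F.limitin_T[OF f])
    show "?g A \<in> carrier (taylor_polydisk n r)" for A
      by (intro F.diff_closed canonical_lift_ordering_map_closed t)
    fix \<rho> assume \<rho>: "\<rho> \<in> radii r"
    \<comment> \<open>Since the projection of \<open>f\<close> vanishes, \<open>?g A - f\<close>
      equals \<open>?h\<close> minus the projection of \<open>?h\<close>; the projection is
      contractive, hence the factor 2.\<close>
    have bound: "free_norm n \<rho> (\<lambda>\<alpha>. ?g A \<alpha> - f \<alpha>) \<le> 2 * free_norm n \<rho> (\<lambda>\<alpha>. ?t A \<alpha> - f \<alpha>)" for A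
    proof -
      let ?h = "\<lambda>\<alpha>. ?t A \<alpha> - f \<alpha>"
      have h: "?h \<in> carrier (taylor_polydisk n r)" by (rule F.diff_closed[OF t f])
      have "canonical_lift q n (ordering_map q n f) =
          (\<lambda>_. 0)" using f0 by (simp add: canonical_lift_def fun_eq_iff)
      then have "(\<lambda>\<alpha>. ?g A \<alpha> - f \<alpha>) = (\<lambda>\<alpha>. ?h \<alpha> - canonical_lift q n (ordering_map q n ?h) \<alpha>)"
        unfolding canonical_lift_ordering_map_diff by (simp add: algebra_simps)
      then show ?thesis
        using F.N_diff[OF \<rho> h canonical_lift_ordering_map_closed[OF h]] canonical_lift_ordering_map_norm_le[OF \<rho> h]
            by simp
    qed
    show "((\<lambda>A. free_norm n \<rho> (\<lambda>\<alpha>. ?g A \<alpha> - f \<alpha>)) \<longlongrightarrow> 0) (finite_subsets_at_top (words n))"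
    proof (rule tendsto_sandwich[OF _ _ tendsto_const])
      show "((\<lambda>A. 2 * free_norm n \<rho> (\<lambda>\<alpha>. ?t A \<alpha> - f \<alpha>)) \<longlongrightarrow> 0) (finite_subsets_at_top (words n))"
        using tendsto_mult_right_zero[OF truncation_tendsto[OF f \<rho>]] .
    qed (use bound in \<open>auto intro!: always_eventually F.N_nonneg[OF \<rho>]
        F.diff_closed canonical_lift_ordering_map_closed t f\<close>)
  qed
  moreover have "\<forall>\<^sub>F A in finite_subsets_at_top (words n). ?g A \<in> I"
    by (intro eventually_finite_subsets_at_top_weakI finite_diff_lift_ordering_map q)
  ultimately show "f \<in> I"
    by (rule limitin_closedin[OF _ closed]) (rule finite_subsets_at_top_neq_bot)
qed

text \<open>The kernel is itself one of the closed ideals in the intersection, and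
  \<open>ordering_map_kernel_subset\<close> places it inside all the others.\<close>

lemma a_kernel_ordering_map_generated:
  "a_kernel (taylor_polydisk n r) (quantum_polydisk q n r) (ordering_map q n) =
    closed_ideal_generated (taylor_polydisk n r) (taylor_topology n r)
      {free_gen i \<otimes>\<^bsub>taylor_polydisk n r\<^esub> free_gen j \<ominus>\<^bsub>taylor_polydisk n r\<^esub>
        q \<odot>\<^bsub>taylor_polydisk n r\<^esub> (free_gen j \<otimes>\<^bsub>taylor_polydisk n r\<^esub> free_gen i) | i j.
          1 \<le> i \<and> i < j \<and> j \<le> n}"
  (is "?K = closed_ideal_generated ?F ?T ?S")
proof -
  have closed: "(\<lambda>\<alpha>. q * word_series [j, i] \<alpha>) \<in> carrier ?F" if "i \<in> {1..n}" "j \<in> {1..n}" for i j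
    using module.smult_closed[OF module_taylor_polydisk, of q "word_series [j, i]" n r] that
    by (simp add: word_series_closed taylor_polydisk_simps ring_of_type_algebra_def)
  \<comment> \<open>The generators are turned into coefficient functions, the form assumed by
    \<open>relation_ideal\<close>.\<close>
  have S: "?S = {\<lambda>\<alpha>. word_series [i, j] \<alpha> - q * word_series [j, i] \<alpha> | i j. 1 \<le> i \<and> i < j \<and> j \<le> n}"
  proof -
    have "free_gen i \<otimes>\<^bsub>?F\<^esub> free_gen j \<ominus>\<^bsub>?F\<^esub> q \<odot>\<^bsub>?F\<^esub> (free_gen j \<otimes>\<^bsub>?F\<^esub> free_gen i) =
        (\<lambda>\<alpha>. word_series [i, j] \<alpha> - q * word_series [j, i] \<alpha>)" if "1 \<le> i" "i < j" "j \<le> n" for i j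
      using that closed[of i j]
      by (simp add: free_gen_eq word_series_mult taylor_polydisk_simps taylor_polydisk_minus)
    then show ?thesis by (intro Collect_cong ex_cong1) (metis (lifting))
  qed
  have hom: "ring_hom_ring ?F (quantum_polydisk q n r) (ordering_map q n)"
    using ordering_map_hom[OF q] by (intro ring_hom_ringI2 ring_taylor_polydisk ring_quantum_polydisk q)
      (simp add: algebra_hom_def)
  have "?S \<subseteq> ?K"
    unfolding S a_kernel_ordering_map using q ordering_map_relation closed
    by (auto intro!: F.diff_closed word_series_closed)
  moreover have "closedin ?T ?K"
    using complemented_a_kernel_ordering_map by (simp add: complemented_subspace_def)
  moreover have "ideal ?K ?F"
    by (rule ring_hom_ring.kernel_is_ideal[OF hom])
  moreover have "?K \<subseteq> I" if "ideal I ?F" "closedin ?T I" "?S \<subseteq> I" for I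
  proof -
    have "relation_ideal I n r q"
      using that(1,3) unfolding S relation_ideal_def relation_ideal_axioms_def by blast
    then show ?thesis
      using ordering_map_kernel_subset that(2) by (auto simp: a_kernel_ordering_map)
  qed
  ultimately show ?thesis
    unfolding closed_ideal_generated_def by (intro equalityI Inter_greatest Inter_lower) auto
qed

text \<open>Contractivity gives the lower bound, and the isometric lift of \<open>f\<close> attains
  it, so the infimum is a minimum.\<close>

lemma quantum_norm_quotient:
  assumes "\<rho> \<in> radii r" "f \<in> carrier (quantum_polydisk q n r)"
  shows "quantum_norm q n \<rho> f = (INF a\<in>{a \<in> carrier (taylor_polydisk n r). ordering_map q n a =
      f}. free_norm n \<rho> a)"
proof (rule cInf_eq_minimum[symmetric])
  show "quantum_norm q n \<rho> f \<in> free_norm n \<rho> ` {a \<in> carrier (taylor_polydisk n r). ordering_map q n a = f}"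
    using canonical_lift_closed[OF assms(2)] ordering_map_lift_carrier[OF q assms(2)] canonical_lift_norm[of n \<rho> q f]
    by (intro image_eqI[of _ _ "canonical_lift q n f"]) auto
qed (use ordering_map_norm_le[OF q _ assms(1)] in auto)

end

theorem theorem3p19:
  fixes q :: complex and n :: nat and r :: ereal
  assumes "q \<noteq> 0" and "1 \<le> n" and "0 < r"
  defines "F \<equiv> taylor_polydisk n r" and "TF \<equiv> taylor_topology n r"
    and "Q \<equiv> quantum_polydisk q n r" and "TQ \<equiv> quantum_topology q n r"
  shows "\<exists>\<pi>.
     (\<pi> \<in> algebra_hom F Q \<and> continuous_map TF TQ \<pi> \<and> \<pi> ` carrier F = carrier Q \<and>
      (\<forall>i\<in>{1..n}. \<pi> (free_gen i) = quantum_gen i)) \<and>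
     a_kernel F Q \<pi> =
       closed_ideal_generated F TF
         {free_gen i \<otimes>\<^bsub>F\<^esub> free_gen j \<ominus>\<^bsub>F\<^esub> q \<odot>\<^bsub>F\<^esub> (free_gen j \<otimes>\<^bsub>F\<^esub> free_gen i) | i j.
            1 \<le> i \<and> i < j \<and> j \<le> n} \<and>
     complemented_subspace F TF (a_kernel F Q \<pi>) \<and>
     (\<forall>\<rho>\<in>radii r. \<forall>f\<in>carrier Q.
        quantum_norm q n \<rho> f = (INF a\<in>{a \<in> carrier F. \<pi> a = f}. free_norm n \<rho> a))"
  unfolding F_def TF_def Q_def TQ_def
proof (intro exI[of _ "ordering_map q n"] conjI ballI)
  note q = assms(1) and r = assms(3)
  show "ordering_map q n ` carrier (taylor_polydisk n r) = carrier (quantum_polydisk q n r)"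
  proof
    \<comment> \<open>Preimages are supplied by \<open>canonical_lift\<close>.\<close>
    show "carrier (quantum_polydisk q n r) \<subseteq> ordering_map q n ` carrier (taylor_polydisk n r)"
    proof
      fix f assume f: "f \<in> carrier (quantum_polydisk q n r)"
      show "f \<in> ordering_map q n ` carrier (taylor_polydisk n r)"
        using canonical_lift_closed[OF f] ordering_map_lift_carrier[OF q f]
            by (intro image_eqI[of _ _ "canonical_lift q n f"]) simp_all
    qed
  qed (use ordering_map_closed[OF q] in blast)
  show "ordering_map q n \<in> algebra_hom (taylor_polydisk n r) (quantum_polydisk q n r)"
    by (rule ordering_map_hom[OF q])
  show "continuous_map (taylor_topology n r) (quantum_topology q n r) (ordering_map q n)"
    by (rule continuous_map_ordering_map[OF q r])
  show "ordering_map q n (free_gen i) = quantum_gen i" if "i \<in> {1..n}" for i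
    using that by (rule ordering_map_free_gen)
\<comment> \<open>What remains are the generators of the kernel, its complement and the quotient
  norm; the membership premises of the last close by assumption.\<close>
qed (rule a_kernel_ordering_map_generated[OF assms(1,3)] complemented_a_kernel_ordering_map[OF assms(1,3)]
    quantum_norm_quotient[OF assms(1,3)], assumption?)+

end
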